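(* Let $D$ be a $\chi$-colored diagram of an oriented link $L\subset S^3$. Then the holonomy representation of $D$ agrees with the holonomy representation generated by the face maps of the associated four-term decomposition (the comparison being made in $\mathrm{PSL}_2(\mathbb C)$, under the identification of groupoids in the context).
   Context: **Crossings.** A segment of $D$ is an edge of the underlying 4-valent planar graph, a region is a component of its complement in $S^2$. Each crossing is drawn with both strands running left to right: incoming segments $1$ (top left), $2$ (bottom left); outgoing segments $2'$ (top right), $1'$ (bottom right); strands run $1\to1'$ and $2\to2'$. At a positive crossing $1\to1'$ passes over; at a negative crossing $2\to2'$ passes over. Adjacent regions: $N$ (between $1,2'$), $W$ (between $1,2$), $S$ (between $2,1'$), $E$ (between $2',1'$). **$\chi$-colorings.** A $\chi$-color is $(a,b,m)\in(\mathbb C\setminus\{0\})^3$. The birational map $B(\chi_1,\chi_2)=(\chi_{2'},\chi_{1'})$ is given by $m_{1'}=m_1$, $m_{2'}=m_2$, $a_{1'}=a_1A^{-1}$, $a_{2'}=a_2A$ with $A=1-\frac{m_1b_1}{b_2}(1-\frac{a_1}{m_1})(1-\frac1{m_2a_2})$, and $$b_{1'}=\tfrac{m_2b_2}{m_1}\bigl(1-m_2a_2(1-\tfrac{b_2}{m_1b_1})\bigr)^{-1},\quad b_{2'}=b_1\bigl(1-\tfrac{m_1}{a_1}(1-\tfrac{b_2}{m_1b_1})\bigr).$$ Its inverse $B^{-1}(\chi_1,\chi_2)=(\chi_{2'},\chi_{1'})$ is given by $m_{1'}=m_1$, $m_{2'}=m_2$, $a_{1'}=a_1\tilde A^{-1}$,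 $a_{2'}=a_2\tilde A$ with $\tilde A=1-\frac{b_2}{m_1b_1}(1-m_1a_1)(1-\frac{m_2}{a_2})$, and $$b_{1'}=\tfrac{m_2b_2}{m_1}\bigl(1-\tfrac{a_2}{m_2}(1-\tfrac{m_1b_1}{b_2})\bigr),\quad b_{2'}=b_1\bigl(1-\tfrac1{m_1a_1}(1-\tfrac{m_1b_1}{b_2})\bigr)^{-1}.$$ $D$ is $\chi$-colored if each segment $i$ is assigned a color $\chi_i=(a_i,b_i,m_i)\in(\mathbb C\setminus\{0\})^3$ such that $B(\chi_1,\chi_2)=(\chi_{2'},\chi_{1'})$ at each positive crossing and $B^{-1}(\chi_1,\chi_2)=(\chi_{2'},\chi_{1'})$ at each negative crossing. **Diagram groupoid and holonomy.** $\Pi_1(D)$ is the groupoid with one object per region and, for each segment $j$, two generators $x_j^{+},x_j^{-}$ from the region on the left of $j$ to the region on the right of $j$ (paths passing above, resp. below, segment $j$), subject at each crossing to $x_1^\pm x_2^\pm=x_{2'}^\pm x_{1'}^\pm$ and to $x_1^-x_2^+=x_{2'}^+x_{1'}^-$ (positive crossing) or $x_1^+x_2^-=x_{2'}^-x_{1'}^+$ (negative crossing). Words are composed left to right. It is equivalent to $\pi_1(S^3\setminus L)$. The holonomy representation of $D$ is $\rho:\Pi_1(D)\to\mathrm{GL}_2(\mathbb C)$, $$\rho(x^+)=\begin{bmatrix}a&0\\(a-1/m)/b&1\end{bmatrix},\qquad \rho(x^-)=\begin{bmatrix}1&(a-m)b\\0&a\end{bmatrix}$$ for a segment with color $(a,b,m)$.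 Matrices act on $\widehat{\mathbb C}=\mathbb C\cup\{\infty\}$ on the right by $z\cdot\begin{bmatrix}\alpha&\beta\\\gamma&\delta\end{bmatrix}=\frac{\alpha z+\gamma}{\beta z+\delta}$, and in this way $\rho$ is compared with maps in $\mathrm{PSL}_2(\mathbb C)=\mathrm{PGL}_2(\mathbb C)$. **Four-term decomposition.** At each crossing there is an ideal octahedron with ideal vertices $P_1$ (on strand $1\to1'$), $P_2$ (on strand $2\to2'$), two vertices $P_+,P_+'$ pulled above the diagram and identified, and two vertices $P_-,P_-'$ pulled below and identified. Adding the edge $P_1P_2$ divides it into four ideal tetrahedra $\tau_N,\tau_W,\tau_S,\tau_E$, one per adjacent region. The octahedra glue to a decomposition of $S^3\setminus(L\cup\{P_+,P_-\})$. Each tetrahedron is placed with vertices in $\widehat{\mathbb C}=\partial\mathbb H^3$: its vertex of type $P_-$ at $0$, its vertex of type $P_+$ at $\infty$, and $$\begin{array}{c|cc}&P_1&P_2\\\hline \tau_N&-1/b_1&-1/b_{2'}\\ \tau_W&-1/(m_1b_1)&-1/b_2\\ \tau_S&-1/(m_1b_{1'})&-1/(m_2b_2)\\ \tau_E&-1/b_{1'}&-1/(m_2b_{2'})\end{array}$$ (at positive and at negative crossings). At a crossing, the tetrahedra of the two regions separated by a segment share a face containing $P_1,P_2$ and one further vertex. At a positive crossing this vertex is of type $P_-$ for segments $1,1'$ and of type $P_+$ for segments $2,2'$; at a negative crossing it is of type $P_+$ for $1,1'$ and $P_-$ for $2,2'$. All other faces are shared by tetrahedra in the same region. **Face maps.**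 When two tetrahedra are glued along a face they in general disagree about where the vertices of that face are; the face map is the element of $\mathrm{PSL}_2(\mathbb C)$ (right action by fractional linear transformations) sending the vertices of the face as placed in the first tetrahedron to the vertices as placed in the second. Together the face maps give a representation of $\pi_1(S^3\setminus L)$ into $\mathrm{PSL}_2(\mathbb C)$, more precisely of the fundamental groupoid of $S^3\setminus L$ with one basepoint for every tetrahedron. This groupoid is compared with $\Pi_1(D)$ by sending each tetrahedron to the region it lies in, a path through a face between tetrahedra in the same region to the identity, and the path from the left to the right of a segment $j$ through a face $P_1P_2P_{+}$ (resp. $P_1P_2P_-$) at a crossing to $x_j^+$ (resp. $x_j^-$). *)

theory Defs
  imports "HOL-Analysis.Analysis" "HOL-Algebra.Coset"
begin

section \<open>Groupoids given by generators and relations\<close>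

record ('v, 'e) quiver =
  objs :: "'v set"
  gens :: "'e set"
  src :: "'e \<Rightarrow> 'v"
  tgt :: "'e \<Rightarrow> 'v"

text \<open>The letter \<open>(e, True)\<close> is the generator \<open>e\<close>, and \<open>(e, False)\<close> is its formal inverse.
  Words are composed from left to right.\<close>

type_synonym 'e word = "('e \<times> bool) list"

record ('v, 'e) groupoid_pres = "('v, 'e) quiver" +
  rels :: "('e word \<times> 'e word) set"

definition letter_src :: "('v, 'e, 'z) quiver_scheme \<Rightarrow> 'e \<times> bool \<Rightarrow> 'v" where
  "letter_src Q l = (if snd l then src Q (fst l) else tgt Q (fst l))"

definition letter_tgt :: "('v, 'e, 'z) quiver_scheme \<Rightarrow> 'e \<times> bool \<Rightarrow> 'v" where
  "letter_tgt Q l = (if snd l then tgt Q (fst l) else src Q (fst l))"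

fun is_walk :: "('v, 'e, 'z) quiver_scheme \<Rightarrow> 'v \<Rightarrow> 'e word \<Rightarrow> 'v \<Rightarrow> bool" where
  "is_walk Q u [] v \<longleftrightarrow> u \<in> objs Q \<and> u = v"
| "is_walk Q u (l # w) v \<longleftrightarrow>
     u \<in> objs Q \<and> fst l \<in> gens Q \<and> letter_src Q l = u \<and> is_walk Q (letter_tgt Q l) w v"

text \<open>The morphisms from \<open>u\<close> to \<open>v\<close> of the presented groupoid are the walks from \<open>u\<close> to \<open>v\<close> up to
  \<open>walk_eq\<close>; functions on morphisms are functions on walks that respect \<open>walk_eq\<close>.\<close>

inductive walk_eq :: "('v, 'e) groupoid_pres \<Rightarrow> 'e word \<Rightarrow> 'e word \<Rightarrow> bool" for P where
  refl: "is_walk P u w v \<Longrightarrow> walk_eq P w w"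
| sym: "walk_eq P w w' \<Longrightarrow> walk_eq P w' w"
| trans: "walk_eq P w w' \<Longrightarrow> walk_eq P w' w'' \<Longrightarrow> walk_eq P w w''"
| cancel: "is_walk P u (p @ [(e, d), (e, \<not> d)] @ q) v \<Longrightarrow>
           walk_eq P (p @ [(e, d), (e, \<not> d)] @ q) (p @ q)"
| rel: "is_walk P u (p @ r @ q) v \<Longrightarrow> (r, r') \<in> rels P \<Longrightarrow> walk_eq P (p @ r @ q) (p @ r' @ q)"

definition groupoid_rep ::
  "('v, 'e) groupoid_pres \<Rightarrow> ('g, 'z) monoid_scheme \<Rightarrow> ('e word \<Rightarrow> 'g) \<Rightarrow> bool" where
  "groupoid_rep P G \<Phi> \<longleftrightarrow>
     (\<forall>u w v. is_walk P u w v \<longrightarrow> \<Phi> w \<in> carrier G) \<and>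
     (\<forall>u w v w' z. is_walk P u w v \<longrightarrow> is_walk P v w' z \<longrightarrow> \<Phi> (w @ w') = \<Phi> w \<otimes>\<^bsub>G\<^esub> \<Phi> w') \<and>
     (\<forall>w w'. walk_eq P w w' \<longrightarrow> \<Phi> w = \<Phi> w')"

definition groupoid_functor ::
  "('v, 'e) groupoid_pres \<Rightarrow> ('u, 'f) groupoid_pres \<Rightarrow> ('v \<Rightarrow> 'u) \<Rightarrow> ('e word \<Rightarrow> 'f word) \<Rightarrow> bool" where
  "groupoid_functor P Q F0 F \<longleftrightarrow>
     (\<forall>u w v. is_walk P u w v \<longrightarrow> is_walk Q (F0 u) (F w) (F0 v)) \<and>
     (\<forall>u w v w' z. is_walk P u w v \<longrightarrow> is_walk P v w' z \<longrightarrow> walk_eq Q (F (w @ w')) (F w @ F w')) \<and>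
     (\<forall>w w'. walk_eq P w w' \<longrightarrow> walk_eq Q (F w) (F w'))"

definition word_inv :: "'e word \<Rightarrow> 'e word" where
  "word_inv w = map (\<lambda>(e, d). (e, \<not> d)) (rev w)"

definition word_subst :: "('e \<Rightarrow> 'f word) \<Rightarrow> 'e word \<Rightarrow> 'f word" where
  "word_subst f w = concat (map (\<lambda>(e, d). if d then f e else word_inv (f e)) w)"

fun word_eval :: "('g, 'z) monoid_scheme \<Rightarrow> ('e \<Rightarrow> 'g) \<Rightarrow> 'e word \<Rightarrow> 'g" where
  "word_eval G f [] = \<one>\<^bsub>G\<^esub>"
| "word_eval G f (l # w) =
     (if snd l then f (fst l) else inv\<^bsub>G\<^esub> (f (fst l))) \<otimes>\<^bsub>G\<^esub> word_eval G f w"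


section \<open>The groups and the action on the Riemann sphere\<close>

definition GL2 :: "(complex^2^2) monoid" where
  "GL2 = \<lparr>carrier = {M. det M \<noteq> 0}, mult = (**), one = mat 1\<rparr>"

definition scalar_matrices :: "(complex^2^2) set" where
  "scalar_matrices = {mat c | c. c \<noteq> 0}"

definition PGL2 :: "(complex^2^2) set monoid" where
  "PGL2 = GL2 Mod scalar_matrices"

definition pgl :: "complex^2^2 \<Rightarrow> (complex^2^2) set" where
  "pgl M = scalar_matrices #>\<^bsub>GL2\<^esub> M"

text \<open>The Riemann sphere is \<open>complex option\<close>, with \<open>None\<close> the point at infinity. The action is a
  right action, so that it is compatible with left-to-right composition.\<close>

fun moebius :: "complex option \<Rightarrow> complex^2^2 \<Rightarrow> complex option" where
  "moebius None M = (if M$1$2 = 0 then None else Some (M$1$1 / M$1$2))"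
| "moebius (Some z) M =
     (if M$1$2 * z + M$2$2 = 0 then None
      else Some ((M$1$1 * z + M$2$1) / (M$1$2 * z + M$2$2)))"


section \<open>Oriented link diagrams\<close>

datatype strand = Strand1 | Strand2
datatype side = LeftSide | RightSide
datatype corner = North | West | South | East

text \<open>At a crossing the segments \<open>1, 2, 1', 2'\<close> are
  \<open>In Strand1, In Strand2, Out Strand1, Out Strand2\<close>.\<close>

datatype slot = In strand | Out strand

fun slot_strand :: "slot \<Rightarrow> strand" where
  "slot_strand (In i) = i"
| "slot_strand (Out i) = i"

fun corner_at :: "slot \<Rightarrow> side \<Rightarrow> corner" where
  "corner_at (In Strand1) LeftSide = North"
| "corner_at (In Strand1) RightSide = West"
| "corner_at (In Strand2) LeftSide = West"
| "corner_at (In Strand2) RightSide = South"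
| "corner_at (Out Strand1) LeftSide = East"
| "corner_at (Out Strand1) RightSide = South"
| "corner_at (Out Strand2) LeftSide = North"
| "corner_at (Out Strand2) RightSide = East"

record ('x, 's, 'r) diagram =
  crossings :: "'x set"
  regions :: "'r set"
  positive :: "'x \<Rightarrow> bool"
  seg :: "'x \<Rightarrow> slot \<Rightarrow> 's"
  corner_region :: "'x \<Rightarrow> corner \<Rightarrow> 'r"
  seg_region :: "'s \<Rightarrow> side \<Rightarrow> 'r"

definition segments :: "('x, 's, 'r) diagram \<Rightarrow> 's set" where
  "segments D = {seg D x \<sigma> | x \<sigma>. x \<in> crossings D}"

definition crossing_adj :: "('x, 's, 'r) diagram \<Rightarrow> ('x \<times> 'x) set" where
  "crossing_adj D =
     {(x, y). x \<in> crossings D \<and> y \<in> crossings D \<and> (\<exists>\<sigma> \<tau>. seg D x \<sigma> = seg D y \<tau>)}"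

definition graph_components :: "('x, 's, 'r) diagram \<Rightarrow> 'x set set" where
  "graph_components D = crossings D // (crossing_adj D)\<^sup>*"

definition region_adj :: "('x, 's, 'r) diagram \<Rightarrow> ('r \<times> 'r) set" where
  "region_adj D = {(seg_region D s d, seg_region D s d') | s d d'. s \<in> segments D}"

text \<open>Diagrams on the sphere are encoded combinatorially. Every segment leaves exactly one crossing
  and enters exactly one crossing, and the regions around a crossing match the regions beside the
  segments. The last two conditions say that the surface is the sphere: the regions are connected
  to each other across segments, and Euler's formula \<open>V - E + F = 1 + c\<close> holds for the 4-valent
  graph (so \<open>E = 2 V\<close>) with \<open>c\<close> connected components. A region is a label and not an orbit of
  segment sides because the boundary of a region of a disconnected diagram can be disconnected.\<close>

definition link_diagram :: "('x, 's, 'r) diagram \<Rightarrow> bool" where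
  "link_diagram D \<longleftrightarrow>
     finite (crossings D) \<and> finite (regions D) \<and>
     bij_betw (\<lambda>(x, i). seg D x (In i)) (crossings D \<times> UNIV) (segments D) \<and>
     bij_betw (\<lambda>(x, i). seg D x (Out i)) (crossings D \<times> UNIV) (segments D) \<and>
     (\<forall>x\<in>crossings D. \<forall>c. corner_region D x c \<in> regions D) \<and>
     (\<forall>x\<in>crossings D. \<forall>\<sigma> d. seg_region D (seg D x \<sigma>) d = corner_region D x (corner_at \<sigma> d)) \<and>
     (\<forall>r\<in>regions D. \<forall>r'\<in>regions D. (r, r') \<in> (region_adj D)\<^sup>*) \<and>
     card (regions D) = card (crossings D) + card (graph_components D) + 1"


section \<open>Colorings\<close>

type_synonym color = "complex \<times> complex \<times> complex"

definition B_map :: "color \<times> color \<Rightarrow> color \<times> color" where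
  "B_map = (\<lambda>((a1, b1, m1), (a2, b2, m2)).
     let A = 1 - m1 * b1 / b2 * (1 - a1 / m1) * (1 - 1 / (m2 * a2))
     in ((a2 * A, b1 * (1 - m1 / a1 * (1 - b2 / (m1 * b1))), m2),
         (a1 * inverse A, m2 * b2 / m1 * inverse (1 - m2 * a2 * (1 - b2 / (m1 * b1))), m1)))"

definition B_inv_map :: "color \<times> color \<Rightarrow> color \<times> color" where
  "B_inv_map = (\<lambda>((a1, b1, m1), (a2, b2, m2)).
     let A = 1 - b2 / (m1 * b1) * (1 - m1 * a1) * (1 - m2 / a2)
     in ((a2 * A, b1 * inverse (1 - 1 / (m1 * a1) * (1 - m1 * b1 / b2)), m2),
         (a1 * inverse A, m2 * b2 / m1 * (1 - a2 / m2 * (1 - m1 * b1 / b2)), m1)))"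

text \<open>Where one of the birational maps is undefined, \<open>inverse 0 = 0\<close> produces a color with a
  vanishing component, so the nonvanishing condition also says that the
  maps are defined.\<close>

definition chi_colored :: "('x, 's, 'r) diagram \<Rightarrow> ('s \<Rightarrow> color) \<Rightarrow> bool" where
  "chi_colored D \<kappa> \<longleftrightarrow>
     (\<forall>s\<in>segments D. \<forall>a b m. \<kappa> s = (a, b, m) \<longrightarrow> a \<noteq> 0 \<and> b \<noteq> 0 \<and> m \<noteq> 0) \<and>
     (\<forall>x\<in>crossings D.
        (if positive D x then B_map else B_inv_map)
          (\<kappa> (seg D x (In Strand1)), \<kappa> (seg D x (In Strand2)))
        = (\<kappa> (seg D x (Out Strand2)), \<kappa> (seg D x (Out Strand1))))"


section \<open>The diagram groupoid and the holonomy representation\<close>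

datatype level = Above | Below

text \<open>The generators \<open>(s, Above)\<close> and \<open>(s, Below)\<close> are the paths passing above and below the
  segment \<open>s\<close>, from its left to its right.\<close>

definition Pi1 :: "('x, 's, 'r) diagram \<Rightarrow> ('r, 's \<times> level) groupoid_pres" where
  "Pi1 D = \<lparr>
     objs = regions D,
     gens = segments D \<times> UNIV,
     src = (\<lambda>(s, l). seg_region D s LeftSide),
     tgt = (\<lambda>(s, l). seg_region D s RightSide),
     rels = {([((seg D x (In Strand1), l1), True), ((seg D x (In Strand2), l2), True)],
              [((seg D x (Out Strand2), l2), True), ((seg D x (Out Strand1), l1), True)])
             | x l1 l2. x \<in> crossings D \<and>
                 (l1 = l2 \<or> (l1, l2) = (if positive D x then (Below, Above) else (Above, Below)))}\<rparr>"

fun rho_gen :: "color \<Rightarrow> level \<Rightarrow> complex^2^2" where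
  "rho_gen (a, b, m) Above = vector [vector [a, 0], vector [(a - 1 / m) / b, 1]]"
| "rho_gen (a, b, m) Below = vector [vector [1, (a - m) * b], vector [0, a]]"

definition holonomy :: "('s \<Rightarrow> color) \<Rightarrow> ('s \<times> level) word \<Rightarrow> complex^2^2" where
  "holonomy \<kappa> = word_eval GL2 (\<lambda>(s, l). rho_gen (\<kappa> s) l)"


section \<open>The four-term decomposition\<close>

text \<open>The tetrahedra are the pairs of a crossing and one of its corners.\<close>

datatype vertex = P_strand strand | P_plus | P_minus

fun place :: "('x, 's, 'r) diagram \<Rightarrow> ('s \<Rightarrow> color) \<Rightarrow> 'x \<times> corner \<Rightarrow> vertex \<Rightarrow> complex option" where
  "place D \<kappa> (x, c) P_minus = Some 0"
| "place D \<kappa> (x, c) P_plus = None"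
| "place D \<kappa> (x, c) (P_strand i) =
     (let (a1, b1, m1) = \<kappa> (seg D x (In Strand1));
          (a2, b2, m2) = \<kappa> (seg D x (In Strand2));
          (a1', b1', m1') = \<kappa> (seg D x (Out Strand1));
          (a2', b2', m2') = \<kappa> (seg D x (Out Strand2))
      in Some (case (c, i) of
           (North, Strand1) \<Rightarrow> - 1 / b1         | (North, Strand2) \<Rightarrow> - 1 / b2'
         | (West, Strand1) \<Rightarrow> - 1 / (m1 * b1)   | (West, Strand2) \<Rightarrow> - 1 / b2
         | (South, Strand1) \<Rightarrow> - 1 / (m1 * b1') | (South, Strand2) \<Rightarrow> - 1 / (m2 * b2)
         | (East, Strand1) \<Rightarrow> - 1 / b1'         | (East, Strand2) \<Rightarrow> - 1 / (m2 * b2')))"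

text \<open>Each octahedron has four inner faces: \<open>Inner x \<sigma>\<close> is the face shared by the tetrahedra on the
  left and on the right of the segment in slot \<open>\<sigma>\<close> at \<open>x\<close>. The remaining faces have vertices
  \<open>P\<^sub>+\<close>, \<open>P\<^sub>-\<close> and one of \<open>P\<^sub>1\<close>, \<open>P\<^sub>2\<close>. They are glued along segments, separately on the two sides:
  if the segment \<open>seg D x (Out i) = seg D y (In j)\<close> runs from \<open>x\<close> to \<open>y\<close>, then \<open>Outer x i y j d\<close>
  glues the tetrahedra at its two ends on the side \<open>d\<close>.\<close>

datatype 'x face = Inner 'x slot | Outer 'x strand 'x strand side

definition faces :: "('x, 's, 'r) diagram \<Rightarrow> 'x face set" where
  "faces D = {Inner x \<sigma> | x \<sigma>. x \<in> crossings D} \<union>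
     {Outer x i y j d | x i y j d.
        x \<in> crossings D \<and> y \<in> crossings D \<and> seg D x (Out i) = seg D y (In j)}"

fun face_src :: "'x face \<Rightarrow> 'x \<times> corner" where
  "face_src (Inner x \<sigma>) = (x, corner_at \<sigma> LeftSide)"
| "face_src (Outer x i y j d) = (x, corner_at (Out i) d)"

fun face_tgt :: "'x face \<Rightarrow> 'x \<times> corner" where
  "face_tgt (Inner x \<sigma>) = (x, corner_at \<sigma> RightSide)"
| "face_tgt (Outer x i y j d) = (y, corner_at (In j) d)"

definition inner_level :: "('x, 's, 'r) diagram \<Rightarrow> 'x \<Rightarrow> slot \<Rightarrow> level" where
  "inner_level D x \<sigma> =
     (case slot_strand \<sigma> of
        Strand1 \<Rightarrow> (if positive D x then Below else Above)
      | Strand2 \<Rightarrow> (if positive D x then Above else Below))"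

fun level_vertex :: "level \<Rightarrow> vertex" where
  "level_vertex Above = P_plus"
| "level_vertex Below = P_minus"

text \<open>The vertices of a face, as pairs of the corresponding vertices of the two tetrahedra.\<close>

fun face_vertices :: "('x, 's, 'r) diagram \<Rightarrow> 'x face \<Rightarrow> (vertex \<times> vertex) set" where
  "face_vertices D (Inner x \<sigma>) =
     Id_on {P_strand Strand1, P_strand Strand2, level_vertex (inner_level D x \<sigma>)}"
| "face_vertices D (Outer x i y j d) =
     {(P_strand i, P_strand j), (P_plus, P_plus), (P_minus, P_minus)}"

definition dual_quiver :: "('x, 's, 'r) diagram \<Rightarrow> ('x \<times> corner, 'x face) quiver" where
  "dual_quiver D = \<lparr>objs = crossings D \<times> UNIV, gens = faces D, src = face_src, tgt = face_tgt\<rparr>"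

text \<open>\<open>around_edge D (p, q) w (p', q')\<close>: all faces crossed by \<open>w\<close> contain the edge which is \<open>p q\<close> in
  the first tetrahedron, and this edge is \<open>p' q'\<close> in the last one.\<close>

fun around_edge ::
  "('x, 's, 'r) diagram \<Rightarrow> vertex \<times> vertex \<Rightarrow> 'x face word \<Rightarrow> vertex \<times> vertex \<Rightarrow> bool" where
  "around_edge D e [] e' \<longleftrightarrow> e = e'"
| "around_edge D e (l # w) e' \<longleftrightarrow>
     (let V = (if snd l then face_vertices D (fst l) else (face_vertices D (fst l))\<inverse>)
      in \<exists>e1. (fst e, fst e1) \<in> V \<and> (snd e, snd e1) \<in> V \<and> around_edge D e1 w e')"

text \<open>The fundamental groupoid of the glued tetrahedra without their ideal vertices, with one
  basepoint for every tetrahedron: walks through faces, where loops around an edge are trivial.\<close>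

definition four_term_groupoid ::
  "('x, 's, 'r) diagram \<Rightarrow> ('x \<times> corner, 'x face) groupoid_pres" where
  "four_term_groupoid D = \<lparr>
     objs = objs (dual_quiver D), gens = gens (dual_quiver D),
     src = src (dual_quiver D), tgt = tgt (dual_quiver D),
     rels = {(w, []) | w.
       \<exists>T p q. p \<noteq> q \<and> is_walk (dual_quiver D) T w T \<and> around_edge D (p, q) w (p, q)}\<rparr>"

definition is_face_map ::
  "('x, 's, 'r) diagram \<Rightarrow> ('s \<Rightarrow> color) \<Rightarrow> 'x face \<Rightarrow> (complex^2^2) set \<Rightarrow> bool" where
  "is_face_map D \<kappa> f g \<longleftrightarrow> g \<in> carrier PGL2 \<and>
     (\<forall>M\<in>g. \<forall>(v, v')\<in>face_vertices D f.
        moebius (place D \<kappa> (face_src f) v) M = place D \<kappa> (face_tgt f) v')"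

definition generated_by_face_maps ::
  "('x, 's, 'r) diagram \<Rightarrow> ('s \<Rightarrow> color) \<Rightarrow> ('x face word \<Rightarrow> (complex^2^2) set) \<Rightarrow> bool" where
  "generated_by_face_maps D \<kappa> \<Phi> \<longleftrightarrow>
     groupoid_rep (four_term_groupoid D) PGL2 \<Phi> \<and>
     (\<forall>f\<in>faces D. is_face_map D \<kappa> f (\<Phi> [(f, True)]))"

text \<open>At a crossing with \<open>b\<^sub>2 = m\<^sub>1 b\<^sub>1\<close> the points \<open>P\<^sub>1\<close> and \<open>P\<^sub>2\<close> are placed at the same point, and the
  inner faces do not determine their face maps.\<close>

definition nondegenerate_face ::
  "('x, 's, 'r) diagram \<Rightarrow> ('s \<Rightarrow> color) \<Rightarrow> 'x face \<Rightarrow> bool" where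
  "nondegenerate_face D \<kappa> f \<longleftrightarrow>
     inj_on (place D \<kappa> (face_src f)) (Domain (face_vertices D f))"


section \<open>Comparison of the groupoids\<close>

definition compare_obj :: "('x, 's, 'r) diagram \<Rightarrow> 'x \<times> corner \<Rightarrow> 'r" where
  "compare_obj D = (\<lambda>(x, c). corner_region D x c)"

fun compare_face :: "('x, 's, 'r) diagram \<Rightarrow> 'x face \<Rightarrow> ('s \<times> level) word" where
  "compare_face D (Inner x \<sigma>) = [((seg D x \<sigma>, inner_level D x \<sigma>), True)]"
| "compare_face D (Outer x i y j d) = []"

definition compare_word :: "('x, 's, 'r) diagram \<Rightarrow> 'x face word \<Rightarrow> ('s \<times> level) word" where
  "compare_word D = word_subst (compare_face D)"

end

theory Submission
  imports Defs
begin

text \<open>The comparison of groupoids respects the relations because of two facts. A loop around the edge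
  \<open>P\<^sub>1 P\<^sub>2\<close> of an octahedron winds around a crossing, and its image is a crossing relation
  of \<open>\<Pi>\<^sub>1(D)\<close>. A loop around any other edge, which has an end \<open>P\<^sub>+\<close> or \<open>P\<^sub>-\<close>, crosses
  segments only above or only below, and in \<open>\<Pi>\<^sub>1(D)\<close> every loop with this property is trivial
  since the diagram lies on a sphere: the segments outside a spanning forest of the graph of
  crossings generate all same-level paths, and by Euler's formula they form a spanning tree of the
  dual graph. It remains to check at each crossing that the matrices \<open>\<rho>(x\<^sup>+)\<close>, \<open>\<rho>(x\<^sup>-)\<close> satisfy the
  relations and move the vertices of the inner faces as required; the outer faces already agree.
  Three distinct points determine an element of \<open>PGL\<^sub>2\<close>, so no other face maps are possible.\<close>

section \<open>Words and walks\<close>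

text \<open>The relators of \<open>four_term_groupoid\<close> are all closed walks around an edge,
  of arbitrary length, so they cannot be listed and checked one by one. The device used instead is a
  potential: a path \<open>g u\<close> from a base object to each object \<open>u\<close>, such that
  \<open>g\<close> followed by a generator equals \<open>g\<close> at its target. A closed walk
  \<open>w\<close> at \<open>u\<close> is then absorbed by \<open>g u\<close>, hence trivial,
  whatever its length. For loops around P_1 P_2 the potential lives on the four corners of one
  crossing; for same-level loops it comes from a tree on the regions, which is found by counting
  because regions are labels without a topology. Existence and uniqueness of face maps have
  different ranges. That the matrices move the vertices correctly is a polynomial consequence of the
  coloring equations and survives when P_1 and P_2 are placed at the same point. There an inner face
  has only two distinct points left, so uniqueness is asserted only along walks through
  nondegenerate faces.\<close>

lemma is_walk_objs:
  assumes "is_walk Q u w v"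
  shows "u \<in> objs Q" "v \<in> objs Q"
  using assms by (induction w arbitrary: u) auto

lemma is_walk_append:
  "is_walk Q u (p @ q) v \<longleftrightarrow> (\<exists>m. is_walk Q u p m \<and> is_walk Q m q v)"
  by (induction p arbitrary: u) (auto dest: is_walk_objs)

lemma is_walk_appendI:
  "is_walk Q u p m \<Longrightarrow> is_walk Q m q v \<Longrightarrow> is_walk Q u (p @ q) v"
  by (auto simp: is_walk_append)

lemma is_walk_gens: "is_walk Q u w v \<Longrightarrow> fst ` set w \<subseteq> gens Q"
  by (induction w arbitrary: u) auto

lemma is_walk_unique: "is_walk Q u w v \<Longrightarrow> is_walk Q u w v' \<Longrightarrow> v = v'"
  by (induction w arbitrary: u) auto

lemma word_inv_simps [simp]:
  "word_inv [] = []"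
  "word_inv (l # w) = word_inv w @ [(fst l, \<not> snd l)]"
  "word_inv (w @ w') = word_inv w' @ word_inv w"
  "word_inv (word_inv w) = w"
  by (auto simp: word_inv_def rev_map o_def split_beta)

lemma is_walk_word_inv:
  assumes "is_walk Q u w v"
  shows "is_walk Q v (word_inv w) u"
  using assms
proof (induction w arbitrary: u)
  case (Cons l w)
  then have "is_walk Q v (word_inv w) (letter_tgt Q l)" by simp
  moreover have "is_walk Q (letter_tgt Q l) [(fst l, \<not> snd l)] u"
    using Cons.prems is_walk_objs(1) by (fastforce simp: letter_src_def letter_tgt_def)
  ultimately show ?case
    using is_walk_append by fastforce
qed simp

text \<open>A word such as \<open>[]\<close> can be a walk at several objects, so \<open>walk_eq\<close> alone is not
  a congruence for concatenation. Fixing the endpoints restores this.\<close>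

definition weq :: "('v, 'e) groupoid_pres \<Rightarrow> 'v \<Rightarrow> 'e word \<Rightarrow> 'e word \<Rightarrow> 'v \<Rightarrow> bool" where
  "weq P u w w' v \<longleftrightarrow> is_walk P u w v \<and> is_walk P u w' v \<and>
     (\<forall>p q s t. is_walk P s p u \<longrightarrow> is_walk P v q t \<longrightarrow> walk_eq P (p @ w @ q) (p @ w' @ q))"

lemma weq_walks:
  assumes "weq P u w w' v"
  shows "is_walk P u w v" "is_walk P u w' v"
  using assms by (simp_all add: weq_def)

lemma weq_context:
  assumes "weq P u w w' v" "is_walk P s p u" "is_walk P v q t"
  shows "walk_eq P (p @ w @ q) (p @ w' @ q)"
  using assms by (auto simp: weq_def)

lemma weq_imp_walk_eq:
  assumes "weq P u w w' v"
  shows "walk_eq P w w'"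
proof -
  have "is_walk P u [] u" "is_walk P v [] v"
    using assms is_walk_objs by (fastforce simp: weq_def)+
  from weq_context[OF assms this] show ?thesis by simp
qed

lemma weq_refl: "is_walk P u w v \<Longrightarrow> weq P u w w v"
  unfolding weq_def by (meson is_walk_append walk_eq.refl)

lemma weq_sym: "weq P u w w' v \<Longrightarrow> weq P u w' w v"
  unfolding weq_def by (meson walk_eq.sym)

lemma weq_trans [trans]: "weq P u w w' v \<Longrightarrow> weq P u w' w'' v \<Longrightarrow> weq P u w w'' v"
  unfolding weq_def by (meson walk_eq.trans)

lemma weq_append:
  assumes a: "weq P u a a' m" and b: "weq P m b b' v"
  shows "weq P u (a @ b) (a' @ b') v"
proof -
  have "walk_eq P (p @ (a @ b) @ q) (p @ (a' @ b') @ q)"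
    if p: "is_walk P s p u" and q: "is_walk P v q t" for p q s t
  proof (rule walk_eq.trans)
    show "walk_eq P (p @ (a @ b) @ q) (p @ (a' @ b) @ q)"
      using weq_context[OF a p is_walk_appendI[OF weq_walks(1)[OF b] q]] by simp
    show "walk_eq P (p @ (a' @ b) @ q) (p @ (a' @ b') @ q)"
      using weq_context[OF b is_walk_appendI[OF p weq_walks(2)[OF a]] q] by simp
  qed
  then show ?thesis
    by (auto simp: weq_def intro: is_walk_appendI weq_walks[OF a] weq_walks[OF b])
qed

lemma weq_append_refl:
  assumes "is_walk P s p u" "weq P u w w' v" "is_walk P v q t"
  shows "weq P s (p @ w @ q) (p @ w' @ q) t"
  using assms by (intro weq_append weq_refl)

lemma weq_cancel_letter:
  assumes "is_walk P u [(e, d)] v"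
  shows "weq P u [(e, d), (e, \<not> d)] [] u"
proof -
  have w: "is_walk P u [(e, d), (e, \<not> d)] u"
    using is_walk_append[of P u "[(e, d)]" "[(e, \<not> d)]" u] is_walk_word_inv[OF assms] assms
    by auto
  moreover have "walk_eq P (p @ [(e, d), (e, \<not> d)] @ q) (p @ [] @ q)"
    if "is_walk P s p u" "is_walk P u q t" for p q s t
  proof -
    have "is_walk P s (p @ [(e, d), (e, \<not> d)] @ q) t"
      by (rule is_walk_appendI[OF that(1) is_walk_appendI[OF w that(2)]])
    then show ?thesis
      using walk_eq.cancel by fastforce
  qed
  ultimately show ?thesis
    using is_walk_objs(1)[OF assms] by (simp add: weq_def)
qed

lemma weq_word_inv_right:
  assumes "is_walk P u w v"
  shows "weq P u (w @ word_inv w) [] u"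
  using assms
proof (induction w arbitrary: u)
  case Nil
  then show ?case by (auto intro: weq_refl)
next
  case (Cons l w)
  let ?m = "letter_tgt P l"
  have w: "is_walk P ?m w v" and l: "is_walk P u [(fst l, snd l)] ?m"
    using Cons.prems is_walk_objs(1) by fastforce+
  have "is_walk P ?m [(fst l, \<not> snd l)] u"
    using is_walk_word_inv[OF l] by (simp del: is_walk.simps)
  then have "weq P u ([(fst l, snd l)] @ (w @ word_inv w) @ [(fst l, \<not> snd l)])
      ([(fst l, snd l)] @ [] @ [(fst l, \<not> snd l)]) u"
    by (rule weq_append_refl[OF l Cons.IH[OF w]])
  also have "weq P u ([(fst l, snd l)] @ [] @ [(fst l, \<not> snd l)]) [] u"
    using weq_cancel_letter[OF l] by simp
  finally show ?case by simp
qed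

lemma weq_word_inv_left:
  assumes "is_walk P u w v"
  shows "weq P v (word_inv w @ w) [] v"
  using weq_word_inv_right[OF is_walk_word_inv[OF assms]] by simp

text \<open>With \<open>weq_cancel_left\<close>, this allows a relation to be solved for a single
  letter, as in a group.\<close>

lemma weq_cancel_right:
  assumes "weq P u (a @ b) c v" "is_walk P u a m" "is_walk P m b v"
  shows "weq P u a (c @ word_inv b) m"
proof -
  have "weq P u (a @ b @ word_inv b) (a @ []) m"
    by (rule weq_append[OF weq_refl weq_word_inv_right]) (use assms in auto)
  moreover have "weq P u (a @ b @ word_inv b) (c @ word_inv b) m"
    using weq_append[OF assms(1) weq_refl[OF is_walk_word_inv[OF assms(3)]]] by simp
  ultimately show ?thesis
    using weq_trans[OF weq_sym] by fastforce
qed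

lemma weq_cancel_left:
  assumes "weq P u (a @ b) c v" "is_walk P u a m" "is_walk P m b v"
  shows "weq P m b (word_inv a @ c) v"
proof -
  have "weq P m (word_inv a @ a @ b) ([] @ b) v"
    using weq_append[OF weq_word_inv_left[OF assms(2)] weq_refl[OF assms(3)]] by simp
  moreover have "weq P m (word_inv a @ a @ b) (word_inv a @ c) v"
    by (rule weq_append[OF weq_refl[OF is_walk_word_inv[OF assms(2)]] assms(1)])
  ultimately show ?thesis
    using weq_trans[OF weq_sym] by fastforce
qed

lemma weq_word_inv:
  assumes "weq P u w w' v"
  shows "weq P v (word_inv w) (word_inv w') u"
proof -
  have v: "is_walk P v [] v"
    using is_walk_objs(2)[OF weq_walks(1)[OF assms]] by simp
  have "weq P u (w' @ []) w v"
    using assms by (simp add: weq_sym)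
  from weq_cancel_left[OF this weq_walks(2)[OF assms] v]
  have "weq P v (word_inv w' @ w) [] v"
    by (rule weq_sym)
  from weq_cancel_right[OF this is_walk_word_inv[OF weq_walks(2)[OF assms]] weq_walks(1)[OF assms]]
  show ?thesis
    by (simp add: weq_sym)
qed

lemma weq_rel:
  assumes "(r, r') \<in> rels P" "is_walk P u r v" "is_walk P u r' v"
  shows "weq P u r r' v"
proof -
  have "walk_eq P (p @ r @ q) (p @ r' @ q)" if "is_walk P s p u" "is_walk P v q t" for p q s t
  proof (rule walk_eq.rel)
    show "is_walk P s (p @ r @ q) t"
      by (rule is_walk_appendI[OF that(1) is_walk_appendI[OF assms(2) that(2)]])
  qed fact
  then show ?thesis
    using assms by (simp add: weq_def)
qed

text \<open>The closing step of every potential argument: a prefix that absorbs \<open>w\<close> is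
  cancelled.\<close>

lemma weq_loop_trivial:
  assumes "weq P r (g @ w) g u" "is_walk P r g u" "is_walk P u w u"
  shows "weq P u w [] u"
  by (rule weq_trans[OF weq_cancel_left[OF assms] weq_word_inv_left[OF assms(2)]])

section \<open>Substitution of words for generators\<close>

lemma word_subst_simps [simp]:
  "word_subst f [] = []"
  "word_subst f (l # w) = (if snd l then f (fst l) else word_inv (f (fst l))) @ word_subst f w"
  "word_subst f (w @ w') = word_subst f w @ word_subst f w'"
  by (auto simp: word_subst_def split_beta)

lemma is_walk_word_subst:
  assumes "is_walk P u w v"
    and "\<And>u. u \<in> objs P \<Longrightarrow> F0 u \<in> objs Q"
    and "\<And>e. e \<in> gens P \<Longrightarrow> src P e \<in> objs P \<Longrightarrow> tgt P e \<in> objs P \<Longrightarrow>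
           is_walk Q (F0 (src P e)) (f e) (F0 (tgt P e))"
  shows "is_walk Q (F0 u) (word_subst f w) (F0 v)"
  using assms(1)
proof (induction w arbitrary: u)
  case (Cons l w)
  have "letter_tgt P l \<in> objs P"
    using Cons.prems is_walk_objs(1) by fastforce
  then have "is_walk Q (F0 u) (if snd l then f (fst l) else word_inv (f (fst l))) (F0 (letter_tgt P l))"
    using Cons.prems assms(3)[of "fst l"]
    by (auto simp: letter_src_def letter_tgt_def split: if_splits intro: is_walk_word_inv)
  then show ?case
    using Cons by (auto simp: is_walk_append)
qed (use assms in auto)

text \<open>A substitution descends to the quotients as soon as it respects the relators. This is
  asked in the form \<open>weq\<close>, with endpoints, because the images are afterwards placed
  inside longer words.\<close>

lemma word_subst_functor:
  assumes objs: "\<And>u. u \<in> objs P \<Longrightarrow> F0 u \<in> objs Q"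
    and gens: "\<And>e. e \<in> gens P \<Longrightarrow> src P e \<in> objs P \<Longrightarrow> tgt P e \<in> objs P \<Longrightarrow>
           is_walk Q (F0 (src P e)) (f e) (F0 (tgt P e))"
    and rels: "\<And>r r' u v. (r, r') \<in> rels P \<Longrightarrow> is_walk P u r v \<Longrightarrow>
           weq Q (F0 u) (word_subst f r) (word_subst f r') (F0 v)"
  shows "groupoid_functor P Q F0 (word_subst f)"
proof -
  have walk: "is_walk Q (F0 u) (word_subst f w) (F0 v)" if "is_walk P u w v" for u w v
    using that objs gens by (rule is_walk_word_subst)
  have "walk_eq Q (word_subst f w) (word_subst f w')" if "walk_eq P w w'" for w w'
    using that
  proof induction
    case (refl u w v)
    show ?case by (rule walk_eq.refl[OF walk[OF refl]])
  next
    case (cancel u p e d q v)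
    then obtain m where m: "is_walk P u p m" "is_walk P m [(e, d), (e, \<not> d)] m" "is_walk P m q v"
      by (auto simp: is_walk_append letter_src_def letter_tgt_def split: if_splits)
    then have "is_walk P m [(e, d)] (letter_tgt P (e, d))"
      using is_walk_append[of P m "[(e, d)]" "[(e, \<not> d)]" m] by auto
    from walk[OF this] have "weq Q (F0 m) (word_subst f [(e, d), (e, \<not> d)]) [] (F0 m)"
      by (cases d) (auto dest!: weq_word_inv_right)
    from weq_imp_walk_eq[OF weq_append_refl[OF walk[OF m(1)] this walk[OF m(3)]]]
    show ?case
      by (metis append_Nil word_subst_simps(3))
  next
    case (rel u p r q v r')
    then obtain m m' where m: "is_walk P u p m" "is_walk P m r m'" "is_walk P m' q v"
      by (auto simp: is_walk_append)
    from weq_imp_walk_eq[OF weq_append_refl[OF walk[OF m(1)] rels[OF rel(2) m(2)] walk[OF m(3)]]]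
    show ?case
      by simp
  qed (auto intro: walk_eq.sym walk_eq.trans)
  moreover have "walk_eq Q (word_subst f (w @ w')) (word_subst f w @ word_subst f w')"
    if "is_walk P u w v" "is_walk P v w' z" for u w v w' z
    using walk_eq.refl[OF walk[of u "w @ w'" z]] that by (auto simp: is_walk_append)
  ultimately show ?thesis
    unfolding groupoid_functor_def using walk by blast
qed

text \<open>Here \<open>g\<close> is a potential: a choice of paths from a base object that is compatible with
  all generators occurring in \<open>w\<close>.\<close>

lemma word_subst_potential:
  assumes "is_walk P u w v" "u \<in> V"
    and gens: "\<And>e. e \<in> fst ` set w \<Longrightarrow> src P e \<in> V \<and> tgt P e \<in> V \<and>
        is_walk Q (F0 (src P e)) (f e) (F0 (tgt P e)) \<and>
        weq Q r (g (src P e) @ f e) (g (tgt P e)) (F0 (tgt P e))"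
    and walk: "\<And>u. u \<in> V \<Longrightarrow> is_walk Q r (g u) (F0 u)"
  shows "weq Q r (g u @ word_subst f w) (g v) (F0 v)"
  using assms(1-3)
proof (induction w arbitrary: u)
  case Nil
  then show ?case by (auto intro!: weq_refl walk)
next
  case (Cons l w)
  let ?m = "letter_tgt P l" and ?f = "if snd l then f (fst l) else word_inv (f (fst l))"
  have w: "is_walk P ?m w v" and objs: "?m \<in> V" "letter_src P l = u"
    using Cons.prems(1) Cons.prems(3)[of "fst l"] by (auto simp: letter_tgt_def)
  have gen: "is_walk Q (F0 (src P (fst l))) (f (fst l)) (F0 (tgt P (fst l)))"
    "weq Q r (g (src P (fst l)) @ f (fst l)) (g (tgt P (fst l))) (F0 (tgt P (fst l)))"
    using Cons.prems(3)[of "fst l"] by (auto simp: letter_src_def letter_tgt_def split: if_splits)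
  have IH: "weq Q r (g ?m @ word_subst f w) (g v) (F0 v)"
    by (rule Cons.IH) (use Cons.prems w objs in auto)
  have step: "weq Q r (g u @ ?f) (g ?m) (F0 ?m)"
  proof (cases "snd l")
    case True
    then show ?thesis using gen objs by (auto simp: letter_src_def letter_tgt_def)
  next
    \<comment> \<open>For a letter traversed backwards, the equation of its generator is solved for
      the potential at the source.\<close>
    case False
    then have "weq Q r (g ?m) (g u @ word_inv (f (fst l))) (F0 ?m)"
      using gen objs weq_cancel_right[OF gen(2) _ gen(1)] walk[of ?m] Cons.prems(2)
      by (auto simp: letter_src_def letter_tgt_def)
    then show ?thesis using False by (simp add: weq_sym)
  qed
  have "is_walk Q (F0 ?m) (word_subst f w) (F0 v)"
  proof -
    obtain k where "is_walk Q r (g ?m) k" "is_walk Q k (word_subst f w) (F0 v)"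
      using weq_walks(1)[OF IH] by (auto simp: is_walk_append)
    then show ?thesis
      using walk[OF objs(1)] is_walk_unique by metis
  qed
  from weq_append[OF step weq_refl[OF this]] have
    "weq Q r ((g u @ ?f) @ word_subst f w) (g ?m @ word_subst f w) (F0 v)" .
  from weq_trans[OF this IH] show ?case by simp
qed

section \<open>Evaluation in a group and representations\<close>

lemma word_eval_closed:
  assumes "group G" "\<And>e. e \<in> fst ` set w \<Longrightarrow> f e \<in> carrier G"
  shows "word_eval G f w \<in> carrier G"
proof -
  interpret group G by fact
  show ?thesis using assms(2) by (induction w) auto
qed

lemma word_eval_append:
  assumes "group G" "\<And>e. e \<in> fst ` set (w @ w') \<Longrightarrow> f e \<in> carrier G"
  shows "word_eval G f (w @ w') = word_eval G f w \<otimes>\<^bsub>G\<^esub> word_eval G f w'"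
proof -
  interpret group G by fact
  have c': "word_eval G f w' \<in> carrier G"
    using assms by (intro word_eval_closed) auto
  show ?thesis
    using assms(2)
  proof (induction w)
    case (Cons l w)
    moreover have "word_eval G f w \<in> carrier G"
      using assms(1) Cons.prems by (intro word_eval_closed) auto
    ultimately show ?case using c' by (auto simp: m_assoc)
  qed (use c' in auto)
qed

text \<open>The universal property of a presentation: evaluation of generators that satisfy the
  relators factors through \<open>walk_eq\<close>.\<close>

lemma word_eval_groupoid_rep:
  assumes "group G" and gens: "\<And>e. e \<in> gens P \<Longrightarrow> f e \<in> carrier G"
    and rels: "\<And>r r'. (r, r') \<in> rels P \<Longrightarrow>
      fst ` set r \<subseteq> gens P \<and> fst ` set r' \<subseteq> gens P \<and> word_eval G f r = word_eval G f r'"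
  shows "groupoid_rep P G (word_eval G f)"
proof -
  interpret group G by fact
  have closed: "word_eval G f w \<in> carrier G" if "fst ` set w \<subseteq> gens P" for w
    using that gens assms(1) by (intro word_eval_closed) auto
  have app: "word_eval G f (w @ w') = word_eval G f w \<otimes>\<^bsub>G\<^esub> word_eval G f w'"
    if "fst ` set w \<subseteq> gens P" "fst ` set w' \<subseteq> gens P" for w w'
    using that gens assms(1) by (intro word_eval_append) auto
  have "word_eval G f w = word_eval G f w'" if "walk_eq P w w'" for w w'
    using that
  proof induction
    case (cancel u p e d q v)
    from is_walk_gens[OF this] have "fst ` set p \<subseteq> gens P" "fst ` set q \<subseteq> gens P" "e \<in> gens P"
      by auto
    then show ?case
      using closed gens by (cases d) (simp_all add: app m_assoc[symmetric])
  next
    case (rel u p r q v r')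
    from is_walk_gens[OF rel(1)] rels[OF rel(2)] show ?case
      by (simp add: app image_Un)
  qed auto
  then show ?thesis
    unfolding groupoid_rep_def
    using closed[OF is_walk_gens] app[OF is_walk_gens is_walk_gens] by simp
qed

lemma groupoid_rep_functor:
  assumes "groupoid_functor P Q F0 F" "groupoid_rep Q G \<Phi>"
  shows "groupoid_rep P G (\<lambda>w. \<Phi> (F w))"
  unfolding groupoid_rep_def
proof (intro conjI allI impI)
  fix u w v w' z
  assume w: "is_walk P u w v" and w': "is_walk P v w' z"
  then have "is_walk Q (F0 u) (F w) (F0 v)" "is_walk Q (F0 v) (F w') (F0 z)"
    and "walk_eq Q (F (w @ w')) (F w @ F w')"
    using assms(1) unfolding groupoid_functor_def by blast+
  then have "\<Phi> (F w @ F w') = \<Phi> (F w) \<otimes>\<^bsub>G\<^esub> \<Phi> (F w')" "\<Phi> (F (w @ w')) = \<Phi> (F w @ F w')"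
    using assms(2) unfolding groupoid_rep_def by blast+
  then show "\<Phi> (F (w @ w')) = \<Phi> (F w) \<otimes>\<^bsub>G\<^esub> \<Phi> (F w')"
    by simp
qed (use assms in \<open>simp_all add: groupoid_functor_def groupoid_rep_def, blast\<close>)

lemma groupoid_rep_hom:
  assumes "groupoid_rep P G \<Phi>" "h \<in> hom G H"
  shows "groupoid_rep P H (\<lambda>w. h (\<Phi> w))"
proof -
  have "\<Phi> w \<in> carrier G" if "is_walk P u w v" for u w v
    using assms(1) that unfolding groupoid_rep_def by blast
  moreover have "h (\<Phi> (w @ w')) = h (\<Phi> w) \<otimes>\<^bsub>H\<^esub> h (\<Phi> w')"
    if "is_walk P u w v" "is_walk P v w' z" for u w v w' z
  proof -
    have "\<Phi> (w @ w') = \<Phi> w \<otimes>\<^bsub>G\<^esub> \<Phi> w'" "\<Phi> w \<in> carrier G" "\<Phi> w' \<in> carrier G"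
      using assms(1) that unfolding groupoid_rep_def by blast+
    then show ?thesis using assms(2) by (simp add: hom_mult)
  qed
  moreover have "h (\<Phi> w) = h (\<Phi> w')" if "walk_eq P w w'" for w w'
    using assms(1) that by (simp add: groupoid_rep_def)
  ultimately show ?thesis
    unfolding groupoid_rep_def using hom_in_carrier[OF assms(2)] by blast
qed

lemma groupoid_rep_Nil:
  assumes "group G" "groupoid_rep P G \<Phi>" "u \<in> objs P"
  shows "\<Phi> [] = \<one>\<^bsub>G\<^esub>"
proof -
  interpret group G by fact
  have "is_walk P u [] u" using assms(3) by simp
  then have "\<Phi> ([] @ []) = \<Phi> [] \<otimes>\<^bsub>G\<^esub> \<Phi> []" and "\<Phi> [] \<in> carrier G"
    using assms(2) unfolding groupoid_rep_def by blast+
  then show ?thesis by (simp add: l_cancel_one')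
qed

text \<open>An arbitrary representation has no formula for inverse letters; its values there are
  forced by the cancellation relation.\<close>

lemma groupoid_rep_False:
  assumes "group G" "groupoid_rep P G \<Phi>" "is_walk P u [(e, True)] v"
  shows "\<Phi> [(e, False)] = inv\<^bsub>G\<^esub> \<Phi> [(e, True)]"
proof -
  interpret group G by fact
  have "is_walk P v [(e, False)] u"
    using is_walk_word_inv[OF assms(3)] by (simp del: is_walk.simps)
  then have "\<Phi> ([(e, False)] @ [(e, True)]) = \<Phi> [(e, False)] \<otimes>\<^bsub>G\<^esub> \<Phi> [(e, True)]"
    and closed: "\<Phi> [(e, True)] \<in> carrier G" "\<Phi> [(e, False)] \<in> carrier G"
    using assms(2,3) unfolding groupoid_rep_def by blast+
  moreover have "walk_eq P ([(e, False)] @ [(e, True)]) []"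
    using weq_imp_walk_eq[OF weq_word_inv_left[OF assms(3)]] by simp
  then have "\<Phi> ([(e, False)] @ [(e, True)]) = \<Phi> []"
    using assms(2) unfolding groupoid_rep_def by blast
  ultimately have "\<Phi> [(e, False)] \<otimes>\<^bsub>G\<^esub> \<Phi> [(e, True)] = \<one>\<^bsub>G\<^esub>"
    using groupoid_rep_Nil[OF assms(1,2) is_walk_objs(1)[OF assms(3)]] by simp
  then show ?thesis
    using closed inv_equality by simp
qed

text \<open>Agreement is assumed only on the generators occurring in \<open>w\<close>. This is what
  allows uniqueness along walks that avoid degenerate faces.\<close>

lemma groupoid_rep_eqI:
  assumes G: "group G" and \<Phi>: "groupoid_rep P G \<Phi>" and \<Psi>: "groupoid_rep P G \<Psi>"
    and "is_walk P u w v" and eq: "\<And>e. e \<in> fst ` set w \<Longrightarrow> \<Phi> [(e, True)] = \<Psi> [(e, True)]"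
  shows "\<Phi> w = \<Psi> w"
  using assms(4,5)
proof (induction w arbitrary: u)
  case Nil
  then show ?case
    using groupoid_rep_Nil[OF G \<Phi>] groupoid_rep_Nil[OF G \<Psi>] is_walk_objs(1) by metis
next
  case (Cons l w)
  obtain e d where l_eq: "l = (e, d)" by fastforce
  let ?m = "letter_tgt P l"
  have w: "is_walk P ?m w v" and l: "is_walk P u [(e, d)] ?m"
    using Cons.prems(1) is_walk_objs(1) l_eq by fastforce+
  have "\<Phi> [(e, d)] = \<Psi> [(e, d)]"
  proof (cases d)
    case True
    then show ?thesis using Cons.prems(2)[of e] l_eq by simp
  next
    case False
    then have e: "is_walk P ?m [(e, True)] u"
      using is_walk_word_inv[OF l] by (simp del: is_walk.simps)
    then show ?thesis
      using groupoid_rep_False[OF G \<Phi> e] groupoid_rep_False[OF G \<Psi> e]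
        Cons.prems(2)[of e] l_eq False by simp
  qed
  moreover have app: "\<Theta> ([(e, d)] @ w) = \<Theta> [(e, d)] \<otimes>\<^bsub>G\<^esub> \<Theta> w" if "groupoid_rep P G \<Theta>" for \<Theta>
    using that l w unfolding groupoid_rep_def by blast
  moreover have "\<Phi> w = \<Psi> w"
    using Cons.IH[OF w] Cons.prems(2) by simp
  ultimately show ?case
    using app[OF \<Phi>] app[OF \<Psi>] l_eq by simp
qed

section \<open>Paths on one side of a planar diagram\<close>

text \<open>\<open>d\<close> is the distance from \<open>T\<close>; the last edge of a shortest path
  starts one step closer. It is applied to the forest of crossings and to the tree of
  regions.\<close>

lemma depth_function:
  fixes R :: "('v \<times> 'v) set"
  assumes "\<And>v. v \<in> V \<Longrightarrow> \<exists>r\<in>T. (r, v) \<in> R\<^sup>*"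
  obtains d :: "'v \<Rightarrow> nat" where "\<And>r. r \<in> T \<Longrightarrow> d r = 0"
    and "\<And>v. v \<in> V - T \<Longrightarrow> \<exists>u. (u, v) \<in> R \<and> d v = Suc (d u)"
proof
  define d where "d v = (LEAST n. \<exists>r\<in>T. (r, v) \<in> R ^^ n)" for v
  show "d r = 0" if "r \<in> T" for r
    unfolding d_def by (rule Least_eq_0) (use that in auto)
  show "\<exists>u. (u, v) \<in> R \<and> d v = Suc (d u)" if v: "v \<in> V - T" for v
  proof -
    have "\<exists>n. \<exists>r\<in>T. (r, v) \<in> R ^^ n"
      using assms v rtrancl_imp_relpow by blast
    from LeastI_ex[OF this] obtain r where r: "r \<in> T" "(r, v) \<in> R ^^ d v"
      unfolding d_def by blast
    with v have "d v \<noteq> 0" by (metis DiffE IdE pair_in_Id_conv relpow.simps(1))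
    then obtain k where k: "d v = Suc k" by (cases "d v") auto
    with r(2) obtain u where u: "(r, u) \<in> R ^^ k" "(u, v) \<in> R" by auto
    have "d u \<le> k"
      unfolding d_def by (rule Least_le) (use r u in blast)
    moreover have "\<exists>r'\<in>T. (r', u) \<in> R ^^ d u"
      unfolding d_def by (rule LeastI[of _ k]) (use r u in blast)
    then have "\<exists>r'\<in>T. (r', v) \<in> R ^^ Suc (d u)"
      using u(2) by auto
    then have "d v \<le> Suc (d u)"
      unfolding d_def[of v] by (rule Least_le)
    ultimately show ?thesis using k u(2) by auto
  qed
qed

fun other_side :: "side \<Rightarrow> side" where
  "other_side LeftSide = RightSide"
| "other_side RightSide = LeftSide"

text \<open>The path from the root down to \<open>v\<close>, read off by climbing to parents. The
  number of steps is an argument, later the depth, which makes the recursion primitive.\<close>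

primrec ancestor_word :: "('v \<Rightarrow> 'v) \<Rightarrow> ('v \<Rightarrow> 'l) \<Rightarrow> nat \<Rightarrow> 'v \<Rightarrow> 'l list" where
  "ancestor_word par lt 0 v = []"
| "ancestor_word par lt (Suc n) v = ancestor_word par lt n (par v) @ [lt v]"

text \<open>The morphism lies in the subgroupoid generated by \<open>A\<close>.\<close>

definition expressible ::
  "('v, 'e) groupoid_pres \<Rightarrow> 'e set \<Rightarrow> 'v \<Rightarrow> 'e word \<Rightarrow> 'v \<Rightarrow> bool" where
  "expressible P A u w v \<longleftrightarrow> (\<exists>w'. weq P u w w' v \<and> fst ` set w' \<subseteq> A)"

text \<open>With this trivial substitution \<open>word_subst_potential\<close> applies to words
  already in the target groupoid.\<close>

lemma word_subst_letters [simp]: "word_subst (\<lambda>e. [(e, True)]) w = w"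
  by (induction w) auto

lemma expressible_self: "is_walk P u w v \<Longrightarrow> fst ` set w \<subseteq> A \<Longrightarrow> expressible P A u w v"
  unfolding expressible_def by (intro exI[of _ w] conjI weq_refl)

lemma expressible_append:
  assumes "expressible P A u a m" "expressible P A m b v"
  shows "expressible P A u (a @ b) v"
proof -
  obtain a' b' where "weq P u a a' m" "fst ` set a' \<subseteq> A" "weq P m b b' v" "fst ` set b' \<subseteq> A"
    using assms by (auto simp: expressible_def)
  then show ?thesis
    unfolding expressible_def by (intro exI[of _ "a' @ b'"] conjI weq_append) auto
qed

lemma fst_set_word_inv [simp]: "fst ` set (word_inv w) = fst ` set w"
  by (induction w) auto

lemma expressible_word_inv:
  assumes "expressible P A u w v"
  shows "expressible P A v (word_inv w) u"
proof -
  obtain w' where "weq P u w w' v" "fst ` set w' \<subseteq> A"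
    using assms by (auto simp: expressible_def)
  then show ?thesis
    unfolding expressible_def by (intro exI[of _ "word_inv w'"] conjI weq_word_inv) simp_all
qed

lemma expressible_weq:
  assumes "weq P u w w' v" "expressible P A u w' v"
  shows "expressible P A u w v"
  using assms(2) weq_trans[OF assms(1)] by (auto simp: expressible_def)

lemma UNIV_strand: "UNIV = {Strand1, Strand2}"
  using strand.exhaust by auto

instance strand :: finite
  by standard (simp add: UNIV_strand)

lemma Pi1_simps [simp]:
  "objs (Pi1 D) = regions D"
  "gens (Pi1 D) = segments D \<times> UNIV"
  "src (Pi1 D) (s, l) = seg_region D s LeftSide"
  "tgt (Pi1 D) (s, l) = seg_region D s RightSide"
  by (simp_all add: Pi1_def)

section \<open>Combinatorics of a planar diagram\<close>

locale planar_diagram =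
  fixes D :: "('x, 's, 'r) diagram"
  assumes diagram: "link_diagram D"
begin

lemma finite_crossings: "finite (crossings D)"
  and finite_regions: "finite (regions D)"
  and bij_In: "bij_betw (\<lambda>(x, i). seg D x (In i)) (crossings D \<times> UNIV) (segments D)"
  and bij_Out: "bij_betw (\<lambda>(x, i). seg D x (Out i)) (crossings D \<times> UNIV) (segments D)"
  and corner_region_regions: "x \<in> crossings D \<Longrightarrow> corner_region D x c \<in> regions D"
  and seg_region_seg:
    "x \<in> crossings D \<Longrightarrow> seg_region D (seg D x \<sigma>) e = corner_region D x (corner_at \<sigma> e)"
  and regions_connected: "r \<in> regions D \<Longrightarrow> r' \<in> regions D \<Longrightarrow> (r, r') \<in> (region_adj D)\<^sup>*"
  and euler: "card (regions D) = card (crossings D) + card (graph_components D) + 1"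
  using diagram unfolding link_diagram_def by auto

lemma seg_segments [simp]: "x \<in> crossings D \<Longrightarrow> seg D x \<sigma> \<in> segments D"
  by (auto simp: segments_def)

lemma segmentsE:
  assumes "s \<in> segments D"
  obtains x \<sigma> where "x \<in> crossings D" "s = seg D x \<sigma>"
  using assms by (auto simp: segments_def)

lemma seg_region_regions [simp]: "s \<in> segments D \<Longrightarrow> seg_region D s e \<in> regions D"
  by (elim segmentsE) (simp add: seg_region_seg corner_region_regions)

lemma seg_In_eq_iff:
  assumes "x \<in> crossings D" "y \<in> crossings D"
  shows "seg D x (In i) = seg D y (In j) \<longleftrightarrow> x = y \<and> i = j"
  using bij_betw_imp_inj_on[OF bij_In] assms by (auto simp: inj_on_def)

lemma seg_Out_eq_iff:
  assumes "x \<in> crossings D" "y \<in> crossings D"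
  shows "seg D x (Out i) = seg D y (Out j) \<longleftrightarrow> x = y \<and> i = j"
  using bij_betw_imp_inj_on[OF bij_Out] assms by (auto simp: inj_on_def)

text \<open>Of three slots two have the same direction, and a segment has only one end of each
  direction.\<close>

lemma at_most_two_ends:
  assumes "x \<in> crossings D" "y \<in> crossings D" "z \<in> crossings D"
    and "seg D x \<sigma> = seg D y \<tau>" "seg D y \<tau> = seg D z \<rho>"
  shows "(x, \<sigma>) = (y, \<tau>) \<or> (y, \<tau>) = (z, \<rho>) \<or> (x, \<sigma>) = (z, \<rho>)"
  using assms by (cases \<sigma>; cases \<tau>; cases \<rho>) (auto simp: seg_In_eq_iff seg_Out_eq_iff)

lemma finite_segments: "finite (segments D)"
  using bij_betw_finite[OF bij_In] finite_crossings by simp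

lemma card_segments: "card (segments D) = 2 * card (crossings D)"
  using bij_betw_same_card[OF bij_In] by (simp add: card_cartesian_product UNIV_strand)

text \<open>\<open>T\<close> is the set of roots, \<open>d\<close> the depth, and \<open>p x\<close> the edge from \<open>x\<close> to its parent.\<close>

lemma spanning_forest:
  obtains T :: "'x set" and d :: "'x \<Rightarrow> nat" and p :: "'x \<Rightarrow> 's"
  where "T \<subseteq> crossings D" "card T \<le> card (graph_components D)"
    and "\<And>x. x \<in> crossings D - T \<Longrightarrow> \<exists>\<sigma> y \<tau>. y \<in> crossings D \<and>
      p x = seg D x \<sigma> \<and> p x = seg D y \<tau> \<and> d x = Suc (d y)"
proof -
  let ?R = "crossing_adj D"
  define T where "T = (\<lambda>X. SOME x. x \<in> X) ` graph_components D"
  have "sym ?R"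
    unfolding sym_def crossing_adj_def by (auto; metis)
  then have sym: "sym (?R\<^sup>*)"
    by (rule sym_rtrancl)
  have closed: "y \<in> crossings D" if "(x, y) \<in> ?R\<^sup>*" "x \<in> crossings D" for x y
    using that by (induction rule: rtrancl_induct) (auto simp: crossing_adj_def)
  have root: "(SOME y. y \<in> ?R\<^sup>* `` {x}) \<in> ?R\<^sup>* `` {x}" for x
    by (rule someI[of _ x]) simp
  have T: "T \<subseteq> crossings D"
  proof
    fix r assume "r \<in> T"
    then obtain x where x: "x \<in> crossings D" "r = (SOME y. y \<in> ?R\<^sup>* `` {x})"
      unfolding T_def graph_components_def by (blast elim: quotientE)
    then show "r \<in> crossings D"
      using root[of x] closed by (metis Image_singleton_iff)
  qed
  have "finite (graph_components D)"
    using finite_crossings by (simp add: graph_components_def quotient_def)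
  then have card_T: "card T \<le> card (graph_components D)"
    unfolding T_def by (rule card_image_le)
  have "\<exists>r\<in>T. (r, x) \<in> ?R\<^sup>*" if "x \<in> crossings D" for x
  proof
    show "(SOME y. y \<in> ?R\<^sup>* `` {x}) \<in> T"
      using that unfolding T_def graph_components_def by (intro imageI quotientI)
    show "((SOME y. y \<in> ?R\<^sup>* `` {x}), x) \<in> ?R\<^sup>*"
      using root[of x] sym by (auto dest: symD)
  qed
  then obtain d where d: "\<And>x. x \<in> crossings D - T \<Longrightarrow> \<exists>y. (y, x) \<in> ?R \<and> d x = Suc (d y)"
    using depth_function[of "crossings D" T ?R] by metis
  have "\<forall>x\<in>crossings D - T. \<exists>s \<sigma> y \<tau>. y \<in> crossings D \<and>
      s = seg D x \<sigma> \<and> s = seg D y \<tau> \<and> d x = Suc (d y)"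
  proof
    fix x assume "x \<in> crossings D - T"
    then obtain y \<sigma> \<tau> where "y \<in> crossings D" "seg D y \<sigma> = seg D x \<tau>" "d x = Suc (d y)"
      using d by (fastforce simp: crossing_adj_def)
    then show "\<exists>s \<sigma> y \<tau>. y \<in> crossings D \<and> s = seg D x \<sigma> \<and> s = seg D y \<tau> \<and> d x = Suc (d y)"
      by metis
  qed
  from bchoice[OF this] obtain p where p: "\<forall>x\<in>crossings D - T. \<exists>\<sigma> y \<tau>. y \<in> crossings D \<and>
      p x = seg D x \<sigma> \<and> p x = seg D y \<tau> \<and> d x = Suc (d y)" ..
  show ?thesis
    by (rule that[OF T card_T bspec[OF p]])
qed

lemma is_walk_segment:
  assumes "x \<in> crossings D"
  shows "is_walk (Pi1 D) (corner_region D x (corner_at \<sigma> LeftSide)) [((seg D x \<sigma>, l), True)]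
    (corner_region D x (corner_at \<sigma> RightSide))"
  using assms
  by (simp add: letter_src_def letter_tgt_def seg_region_seg corner_region_regions)

text \<open>Equal levels serve the generation of same-level paths; the mixed pair of levels is the
  one of the inner faces at the crossing.\<close>

lemma weq_crossing:
  assumes "x \<in> crossings D"
    and "l1 = l2 \<or> (l1, l2) = (if positive D x then (Below, Above) else (Above, Below))"
  shows "weq (Pi1 D) (corner_region D x North)
    ([((seg D x (In Strand1), l1), True)] @ [((seg D x (In Strand2), l2), True)])
    ([((seg D x (Out Strand2), l2), True)] @ [((seg D x (Out Strand1), l1), True)])
    (corner_region D x South)"
proof (rule weq_rel)
  note w = is_walk_segment[OF assms(1)]
  show "is_walk (Pi1 D) (corner_region D x North)
    ([((seg D x (In Strand1), l1), True)] @ [((seg D x (In Strand2), l2), True)])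
    (corner_region D x South)"
    by (rule is_walk_appendI[OF w[of "In Strand1", unfolded corner_at.simps]
          w[of "In Strand2", unfolded corner_at.simps]])
  show "is_walk (Pi1 D) (corner_region D x North)
    ([((seg D x (Out Strand2), l2), True)] @ [((seg D x (Out Strand1), l1), True)])
    (corner_region D x South)"
    by (rule is_walk_appendI[OF w[of "Out Strand2", unfolded corner_at.simps]
          w[of "Out Strand1", unfolded corner_at.simps]])
qed (use assms in \<open>auto simp: Pi1_def\<close>)

text \<open>Each slot occurs exactly once in the same-level crossing relation, which can therefore
  be solved for any of them.\<close>

lemma expressible_slot:
  assumes x: "x \<in> crossings D"
    and others: "\<And>\<tau>. \<tau> \<noteq> \<sigma> \<Longrightarrow> expressible (Pi1 D) A (corner_region D x (corner_at \<tau> LeftSide))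
      [((seg D x \<tau>, l), True)] (corner_region D x (corner_at \<tau> RightSide))"
  shows "expressible (Pi1 D) A (corner_region D x (corner_at \<sigma> LeftSide))
      [((seg D x \<sigma>, l), True)] (corner_region D x (corner_at \<sigma> RightSide))"
proof -
  note wIn1 = is_walk_segment[OF x, of "In Strand1" l, unfolded corner_at.simps]
    and wIn2 = is_walk_segment[OF x, of "In Strand2" l, unfolded corner_at.simps]
    and wOut1 = is_walk_segment[OF x, of "Out Strand1" l, unfolded corner_at.simps]
    and wOut2 = is_walk_segment[OF x, of "Out Strand2" l, unfolded corner_at.simps]
  note oIn1 = others[of "In Strand1", unfolded corner_at.simps]
    and oIn2 = others[of "In Strand2", unfolded corner_at.simps]
    and oOut1 = others[of "Out Strand1", unfolded corner_at.simps]
    and oOut2 = others[of "Out Strand2", unfolded corner_at.simps]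
  have rel: "weq (Pi1 D) (corner_region D x North)
    ([((seg D x (In Strand1), l), True)] @ [((seg D x (In Strand2), l), True)])
    ([((seg D x (Out Strand2), l), True)] @ [((seg D x (Out Strand1), l), True)])
    (corner_region D x South)"
    by (rule weq_crossing[OF x]) simp
  show ?thesis
  proof (cases \<sigma>)
    case (In i)
    show ?thesis
    proof (cases i)
      case Strand1
      show ?thesis
        using expressible_weq[OF weq_cancel_right[OF rel wIn1
              wIn2]]
          expressible_append[OF expressible_append[OF oOut2 oOut1]
            expressible_word_inv[OF oIn2]] In Strand1
        by simp
    next
      case Strand2
      show ?thesis
        using expressible_weq[OF weq_cancel_left[OF rel wIn1
              wIn2]]
          expressible_append[OF expressible_word_inv[OF oIn1]
            expressible_append[OF oOut2 oOut1]] In Strand2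
        by simp
    qed
  next
    case (Out i)
    show ?thesis
    proof (cases i)
      case Strand1
      show ?thesis
        using expressible_weq[OF weq_cancel_left[OF weq_sym[OF rel]
              wOut2 wOut1]]
          expressible_append[OF expressible_word_inv[OF oOut2]
            expressible_append[OF oIn1 oIn2]] Out Strand1
        by simp
    next
      case Strand2
      show ?thesis
        using expressible_weq[OF weq_cancel_right[OF weq_sym[OF rel]
              wOut2 wOut1]]
          expressible_append[OF expressible_append[OF oIn1 oIn2]
            expressible_word_inv[OF oOut1]] Out Strand2
        by simp
    qed
  qed
qed

text \<open>The segments outside a spanning forest generate: going up from the leaves, each forest edge
  is expressed by the other three segments at its lower end.\<close>

lemma generating_segments:
  obtains C where "C \<subseteq> segments D" "card C + 1 \<le> card (regions D)"
    and "\<And>s l. s \<in> segments D \<Longrightarrow> expressible (Pi1 D) (C \<times> {l})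
      (seg_region D s LeftSide) [((s, l), True)] (seg_region D s RightSide)"
proof -
  obtain T d p where T: "T \<subseteq> crossings D" "card T \<le> card (graph_components D)"
    and p: "\<And>x. x \<in> crossings D - T \<Longrightarrow> \<exists>\<sigma> y \<tau>. y \<in> crossings D \<and>
      p x = seg D x \<sigma> \<and> p x = seg D y \<tau> \<and> d x = Suc (d y :: nat)"
    by (rule spanning_forest) auto
  define F where "F = p ` (crossings D - T)"
  have F: "F \<subseteq> segments D"
  proof
    fix s assume "s \<in> F"
    then obtain x where "x \<in> crossings D - T" "s = p x" by (auto simp: F_def)
    then show "s \<in> segments D" using p[of x] by (auto simp: segments_def)
  qed
  \<comment> \<open>Two crossings with the same parent edge would be parents of each other, against
    the depth.\<close>
  have "inj_on p (crossings D - T)"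
  proof (rule inj_onI, rule ccontr)
    fix x y assume x: "x \<in> crossings D - T" and y: "y \<in> crossings D - T"
      and eq: "p x = p y" and "x \<noteq> y"
    obtain \<sigma> u \<tau> where u: "u \<in> crossings D" "p x = seg D x \<sigma>" "p x = seg D u \<tau>" "d x = Suc (d u)"
      using p[OF x] by auto
    obtain \<sigma>' u' \<tau>' where u': "u' \<in> crossings D" "p y = seg D y \<sigma>'" "p y = seg D u' \<tau>'" "d y = Suc (d u')"
      using p[OF y] by auto
    have "y = u"
      using at_most_two_ends[of x u y \<sigma> \<tau> \<sigma>'] x y u u' eq \<open>x \<noteq> y\<close> by auto
    moreover have "x = u'"
      using at_most_two_ends[of y u' x \<sigma>' \<tau>' \<sigma>] x y u u' eq \<open>x \<noteq> y\<close> by auto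
    ultimately show False using u(4) u'(4) by simp
  qed
  then have "card F = card (crossings D) - card T"
    using T(1) finite_crossings by (simp add: F_def card_image card_Diff_subset finite_subset)
  moreover have "card T \<le> card (crossings D)"
    using T(1) finite_crossings by (simp add: card_mono)
  \<comment> \<open>With V crossings, V - \<open>card T\<close> of the 2 V segments lie in the
    forest, which leaves V + \<open>card T\<close>.\<close>
  ultimately have "card (segments D - F) = card (crossings D) + card T"
    using F finite_segments by (simp add: card_Diff_subset finite_subset card_segments)
  then have card: "card (segments D - F) + 1 \<le> card (regions D)"
    using T(2) euler by simp
  have "expressible (Pi1 D) ((segments D - F) \<times> {l})
      (seg_region D s LeftSide) [((s, l), True)] (seg_region D s RightSide)"
    if "s \<in> segments D" for s l
  proof -
    let ?E = "\<lambda>s. expressible (Pi1 D) ((segments D - F) \<times> {l})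
      (seg_region D s LeftSide) [((s, l), True)] (seg_region D s RightSide)"
    have basic: "?E s" if "s \<in> segments D - F" for s
      by (rule expressible_self) (use that in \<open>auto simp: letter_src_def letter_tgt_def\<close>)
    define N where "N = Max (d ` crossings D)"
    have forest: "?E (p x)" if "x \<in> crossings D - T" for x
      using that
    proof (induction "N - d x" arbitrary: x rule: less_induct)
      case less
      have x: "x \<in> crossings D" using less.prems by simp
      obtain \<sigma> u \<tau> where u: "u \<in> crossings D" "p x = seg D x \<sigma>" "p x = seg D u \<tau>" "d x = Suc (d u)"
        using p[OF less.prems] by auto
      have others: "?E (seg D x \<rho>)" if "\<rho> \<noteq> \<sigma>" for \<rho>
      proof (cases "seg D x \<rho> \<in> F")
        case False
        then show ?thesis using basic x by simp
      next
        case True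
        \<comment> \<open>Another forest edge at \<open>x\<close> leads to a child \<open>y\<close>
          of \<open>x\<close>, which is deeper and so covered by the induction hypothesis.\<close>
        then obtain y where y: "y \<in> crossings D - T" "seg D x \<rho> = p y" by (auto simp: F_def)
        obtain \<sigma>' u' \<tau>' where u': "u' \<in> crossings D" "p y = seg D y \<sigma>'" "p y = seg D u' \<tau>'"
          "d y = Suc (d u')"
          using p[OF y(1)] by auto
        \<comment> \<open>Otherwise the parent edge of \<open>x\<close> would have three ends: the
          slots \<open>\<sigma>\<close> and \<open>\<rho>\<close> at \<open>x\<close> and one at the
          parent \<open>u\<close>.\<close>
        have "x \<noteq> y"
        proof
          assume "x = y"
          then have "seg D x \<rho> = seg D x \<sigma>" using u(2) y(2) by simp
          then show False
            using at_most_two_ends[of x x u \<rho> \<sigma> \<tau>] u x that by auto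
        qed
        then have "x = u'"
          using at_most_two_ends[of y u' x \<sigma>' \<tau>' \<rho>] x y u' by auto
        moreover have "d y \<le> N"
          using y finite_crossings by (auto simp: N_def intro!: Max_ge)
        ultimately have "N - d y < N - d x"
          using u'(4) by simp
        from less.hyps[OF this y(1)] show ?thesis
          using y(2) by simp
      qed
      show ?case
        using expressible_slot[OF x, of \<sigma> "(segments D - F) \<times> {l}" l] others u(2)
        by (simp add: seg_region_seg x)
    qed
    show ?thesis
    proof (cases "s \<in> F")
      case True
      then show ?thesis using forest by (auto simp: F_def)
    next
      case False
      then show ?thesis using basic that by simp
    qed
  qed
  with card show ?thesis
    by (rule that[of "segments D - F", OF Diff_subset])
qed

text \<open>By Euler's formula the generating segments are too few to connect the regions by anything
  but a tree.\<close>

lemma planar_potential: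
  obtains r\<^sub>0 g where "\<And>r. r \<in> regions D \<Longrightarrow> is_walk (Pi1 D) r\<^sub>0 (g r) r"
    and "\<And>s. s \<in> segments D \<Longrightarrow> weq (Pi1 D) r\<^sub>0 (g (seg_region D s LeftSide) @ [((s, l), True)])
      (g (seg_region D s RightSide)) (seg_region D s RightSide)"
proof -
  obtain C where C: "C \<subseteq> segments D" "card C + 1 \<le> card (regions D)"
    and gen: "\<And>s. s \<in> segments D \<Longrightarrow> expressible (Pi1 D) (C \<times> {l})
      (seg_region D s LeftSide) [((s, l), True)] (seg_region D s RightSide)"
    using generating_segments by metis
  define R where "R = {(seg_region D s e, seg_region D s e') | s e e'. s \<in> C}"
  have R_I: "(seg_region D s e, seg_region D s e') \<in> R" if "s \<in> C" for s e e'
    using that by (auto simp: R_def)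
  have walk_R: "(u, v) \<in> R\<^sup>*" if "is_walk (Pi1 D) u w v" "fst ` set w \<subseteq> C \<times> {l}" for u w v
    using that
  proof (induction w arbitrary: u)
    case (Cons a w)
    obtain s e where a: "a = ((s, l), e)" "s \<in> C"
      using Cons.prems(2) by (cases a) auto
    have "(u, letter_tgt (Pi1 D) a) \<in> R"
      using Cons.prems(1) a R_I by (auto simp: letter_src_def letter_tgt_def split: if_splits)
    moreover have "(letter_tgt (Pi1 D) a, v) \<in> R\<^sup>*"
      using Cons by simp
    ultimately show ?case by (rule converse_rtrancl_into_rtrancl)
  qed simp
  have "sym R"
    unfolding R_def by (rule symI) blast
  then have symR: "sym (R\<^sup>*)"
    by (rule sym_rtrancl)
  \<comment> \<open>A word over \<open>C\<close> expressing the passage across \<open>s\<close> is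
    also a path in \<open>R\<close> between the sides of \<open>s\<close>. Hence the segments of
    \<open>C\<close> alone connect all regions.\<close>
  have sides: "(seg_region D s LeftSide, seg_region D s RightSide) \<in> R\<^sup>*" if "s \<in> segments D" for s
    using gen[OF that] walk_R weq_walks(2) unfolding expressible_def by metis
  have "region_adj D \<subseteq> R\<^sup>*"
  proof (clarsimp simp: region_adj_def)
    fix s e e' assume "s \<in> segments D"
    then show "(seg_region D s e, seg_region D s e') \<in> R\<^sup>*"
      using sides[of s] symD[OF symR] by (cases e; cases e') auto
  qed
  then have "(region_adj D)\<^sup>* \<subseteq> R\<^sup>*"
    by (metis rtrancl_idemp rtrancl_mono)
  then have conn: "(r, r') \<in> R\<^sup>*" if "r \<in> regions D" "r' \<in> regions D" for r r'
    using regions_connected[OF that] by blast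
  obtain r\<^sub>0 where r0: "r\<^sub>0 \<in> regions D"
    using euler by fastforce
  obtain d where d0: "d r\<^sub>0 = (0::nat)"
    and d: "\<And>r. r \<in> regions D - {r\<^sub>0} \<Longrightarrow> \<exists>u. (u, r) \<in> R \<and> d r = Suc (d u)"
    by (rule depth_function[of "regions D" "{r\<^sub>0}" R]) (use conn r0 in auto)
  have "\<forall>r\<in>regions D - {r\<^sub>0}. \<exists>a. fst a \<in> C \<and> seg_region D (fst a) (snd a) = r \<and>
      d r = Suc (d (seg_region D (fst a) (other_side (snd a))))"
  proof
    fix r assume "r \<in> regions D - {r\<^sub>0}"
    from d[OF this] obtain s e e' where s: "s \<in> C" "r = seg_region D s e'"
      "d r = Suc (d (seg_region D s e))"
      by (auto simp: R_def)
    \<comment> \<open>Equal sides would mean equal regions, hence equal depths.\<close>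
    then have "e = other_side e'"
      by (cases e; cases e') auto
    then show "\<exists>a. fst a \<in> C \<and> seg_region D (fst a) (snd a) = r \<and>
        d r = Suc (d (seg_region D (fst a) (other_side (snd a))))"
      using s by (intro exI[of _ "(s, e')"]) simp
  qed
  \<comment> \<open>\<open>q r\<close> is a segment beside \<open>r\<close> whose other side is one
    step closer to the root, paired with the side on which \<open>r\<close> lies.\<close>
  from bchoice[OF this] obtain q where q: "\<forall>r\<in>regions D - {r\<^sub>0}. fst (q r) \<in> C \<and>
      seg_region D (fst (q r)) (snd (q r)) = r \<and>
      d r = Suc (d (seg_region D (fst (q r)) (other_side (snd (q r)))))" ..
  \<comment> \<open>Two regions choosing the same segment would each be the parent of the
    other.\<close>
  have inj: "inj_on (\<lambda>r. fst (q r)) (regions D - {r\<^sub>0})"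
  proof (rule inj_onI, rule ccontr)
    fix r r' assume r: "r \<in> regions D - {r\<^sub>0}" and r': "r' \<in> regions D - {r\<^sub>0}"
      and eq: "fst (q r) = fst (q r')" and "r \<noteq> r'"
    obtain s e e' where qr: "q r = (s, e)" "q r' = (s, e')"
      using eq by (metis prod.collapse)
    have r_eq: "seg_region D s e = r" "d r = Suc (d (seg_region D s (other_side e)))"
      using bspec[OF q r] qr by simp_all
    have r'_eq: "seg_region D s e' = r'" "d r' = Suc (d (seg_region D s (other_side e')))"
      using bspec[OF q r'] qr by simp_all
    have "e' \<noteq> e"
      using r_eq(1) r'_eq(1) \<open>r \<noteq> r'\<close> by auto
    then have "other_side e = e'" "other_side e' = e"
      by (cases e; cases e'; simp)+
    then have "d r = Suc (d r')" "d r' = Suc (d r)"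
      using r_eq(2) r'_eq(1) r'_eq(2) r_eq(1) by metis+
    then show False by linarith
  qed
  have finC: "finite C"
    using C(1) finite_segments finite_subset by blast
  \<comment> \<open>All regions but one inject into \<open>C\<close>, which has no more elements
    than that; so every generating segment is a tree edge.\<close>
  have "(\<lambda>r. fst (q r)) ` (regions D - {r\<^sub>0}) = C"
  proof (rule card_seteq[OF finC])
    show "(\<lambda>r. fst (q r)) ` (regions D - {r\<^sub>0}) \<subseteq> C"
      using q by auto
    show "card C \<le> card ((\<lambda>r. fst (q r)) ` (regions D - {r\<^sub>0}))"
      using C(2) r0 finite_regions by (simp add: card_image[OF inj])
  qed
  then have tree: "\<exists>r\<in>regions D - {r\<^sub>0}. s = fst (q r)" if "s \<in> C" for s
    using that by auto
  define par where "par r = seg_region D (fst (q r)) (other_side (snd (q r)))" for r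
  \<comment> \<open>Generators run from left to right, so the letter entering \<open>r\<close> is
    positive exactly if \<open>r\<close> is on the right.\<close>
  define lt where "lt r = ((fst (q r), l), snd (q r) = RightSide)" for r
  define g where "g r = ancestor_word par lt (d r) r" for r
  have g0: "g r\<^sub>0 = []"
    by (simp add: g_def d0)
  have g: "g r = g (par r) @ [lt r]" if "r \<in> regions D - {r\<^sub>0}" for r
    using q that by (simp add: g_def par_def)
  have par: "par r \<in> regions D" if "r \<in> regions D - {r\<^sub>0}" for r
    using bspec[OF q that] C(1) by (auto simp: par_def)
  have lt: "is_walk (Pi1 D) (par r) [lt r] r" if r: "r \<in> regions D - {r\<^sub>0}" for r
    using bspec[OF q r] C(1) par[OF r] r
    by (cases "snd (q r)") (auto simp: letter_src_def letter_tgt_def lt_def par_def)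
  have walk: "is_walk (Pi1 D) r\<^sub>0 (g r) r" if "r \<in> regions D" for r
    using that
  proof (induction "d r" arbitrary: r rule: less_induct)
    case less
    show ?case
    proof (cases "r = r\<^sub>0")
      case True
      then show ?thesis using less.prems g0 by simp
    next
      case False
      then have r: "r \<in> regions D - {r\<^sub>0}" using less.prems by simp
      have "d (par r) < d r" using bspec[OF q r] by (simp add: par_def)
      from is_walk_appendI[OF less.hyps[OF this par[OF r]] lt[OF r]]
      show ?thesis unfolding g[OF r] .
    qed
  qed
  have potential_C: "weq (Pi1 D) r\<^sub>0 (g (seg_region D s LeftSide) @ [((s, l), True)])
      (g (seg_region D s RightSide)) (seg_region D s RightSide)" if "s \<in> C" for s
  proof -
    obtain r where r: "r \<in> regions D - {r\<^sub>0}" and s: "s = fst (q r)"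
      using tree[OF \<open>s \<in> C\<close>] by blast
    note qr = bspec[OF q r]
    show ?thesis
    proof (cases "snd (q r)")
      case RightSide
      then have "seg_region D s RightSide = r" "seg_region D s LeftSide = par r"
        using qr s by (simp_all add: par_def)
      then show ?thesis
        using g[OF r] weq_refl[OF walk, of r] r RightSide s by (simp add: lt_def)
    next
      \<comment> \<open>The segment leads from \<open>r\<close> back to its parent, and its letter
        cancels the last letter of \<open>g r\<close>.\<close>
      case LeftSide
      then have sides: "seg_region D s LeftSide = r" "seg_region D s RightSide = par r"
        using qr s by (simp_all add: par_def)
      have lt_r: "lt r = ((s, l), False)"
        using LeftSide s by (simp add: lt_def)
      have "weq (Pi1 D) (par r) ([((s, l), False), ((s, l), True)]) [] (par r)"
        using weq_cancel_letter[OF lt[OF r, unfolded lt_r]] by simp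
      from weq_append[OF weq_refl[OF walk[OF par[OF r]]] this] show ?thesis
        by (simp add: sides g[OF r] lt_r)
    qed
  qed
  show ?thesis
  proof (rule that[OF walk])
    fix s assume s: "s \<in> segments D"
    let ?u = "seg_region D s LeftSide" and ?v = "seg_region D s RightSide"
    \<comment> \<open>The potential passes from \<open>C\<close> to any segment along a word over
      \<open>C\<close> that expresses it.\<close>
    obtain w where w: "weq (Pi1 D) ?u [((s, l), True)] w ?v" "fst ` set w \<subseteq> C \<times> {l}"
      using gen[OF s] by (auto simp: expressible_def)
    have "weq (Pi1 D) r\<^sub>0 (g ?u @ word_subst (\<lambda>e. [(e, True)]) w) (g ?v) (id ?v)"
    proof (rule word_subst_potential[OF weq_walks(2)[OF w(1)], where V = "regions D"])
      fix e assume "e \<in> fst ` set w"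
      then obtain s' where "e = (s', l)" "s' \<in> C" using w(2) by auto
      then show "src (Pi1 D) e \<in> regions D \<and> tgt (Pi1 D) e \<in> regions D \<and>
        is_walk (Pi1 D) (id (src (Pi1 D) e)) [(e, True)] (id (tgt (Pi1 D) e)) \<and>
        weq (Pi1 D) r\<^sub>0 (g (src (Pi1 D) e) @ [(e, True)]) (g (tgt (Pi1 D) e)) (id (tgt (Pi1 D) e))"
        using potential_C[of s'] C(1) by (auto simp: letter_src_def letter_tgt_def)
    qed (use walk s in simp_all)
    moreover have "weq (Pi1 D) r\<^sub>0 (g ?u @ [((s, l), True)]) (g ?u @ w) ?v"
      by (rule weq_append[OF weq_refl[OF walk] w(1)]) (use s in simp)
    ultimately show "weq (Pi1 D) r\<^sub>0 (g ?u @ [((s, l), True)]) (g ?v) ?v"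
      using weq_trans by fastforce
  qed
qed

text \<open>Topologically, such a loop stays in a ball on one side of the projection sphere.\<close>

lemma same_level_loop_trivial:
  assumes w: "is_walk (Pi1 D) u w u" and level: "snd ` fst ` set w \<subseteq> {l}"
  shows "weq (Pi1 D) u w [] u"
proof -
  obtain r\<^sub>0 g where walk: "\<And>r. r \<in> regions D \<Longrightarrow> is_walk (Pi1 D) r\<^sub>0 (g r) r"
    and pot: "\<And>s. s \<in> segments D \<Longrightarrow> weq (Pi1 D) r\<^sub>0 (g (seg_region D s LeftSide) @ [((s, l), True)])
      (g (seg_region D s RightSide)) (seg_region D s RightSide)"
    using planar_potential[of l] by blast
  have "weq (Pi1 D) r\<^sub>0 (g u @ word_subst (\<lambda>e. [(e, True)]) w) (g u) (id u)"
  proof (rule word_subst_potential[OF w, where V = "regions D"])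
    fix e assume "e \<in> fst ` set w"
    then obtain s where "e = (s, l)" "s \<in> segments D"
      using level is_walk_gens[OF w] by fastforce
    then show "src (Pi1 D) e \<in> regions D \<and> tgt (Pi1 D) e \<in> regions D \<and>
        is_walk (Pi1 D) (id (src (Pi1 D) e)) [(e, True)] (id (tgt (Pi1 D) e)) \<and>
      weq (Pi1 D) r\<^sub>0 (g (src (Pi1 D) e) @ [(e, True)]) (g (tgt (Pi1 D) e)) (id (tgt (Pi1 D) e))"
      using pot[of s] by (auto simp: letter_src_def letter_tgt_def)
  qed (use walk is_walk_objs(1)[OF w] in simp_all)
  then have "weq (Pi1 D) r\<^sub>0 (g u @ w) (g u) u" by simp
  then show ?thesis
    by (rule weq_loop_trivial) (use w walk is_walk_objs(1)[OF w] in auto)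
qed

end

section \<open>Moebius transformations\<close>

lemma matrix2_eq_iff:
  fixes A B :: "'a^2^2"
  shows "A = B \<longleftrightarrow> A$1$1 = B$1$1 \<and> A$1$2 = B$1$2 \<and> A$2$1 = B$2$1 \<and> A$2$2 = B$2$2"
  by (auto simp: vec_eq_iff forall_2)

lemma matrix2_mult_nth:
  fixes A B :: "'a::semiring_1^2^2"
  shows "(A ** B)$i$j = A$i$1 * B$1$j + A$i$2 * B$2$j"
  by (simp add: matrix_matrix_mult_def sum_2)

lemma mat2_nth [simp]:
  "(mat c :: 'a::zero^2^2)$1$1 = c" "(mat c :: 'a^2^2)$1$2 = 0"
  "(mat c :: 'a^2^2)$2$1 = 0" "(mat c :: 'a^2^2)$2$2 = c"
  by (simp_all add: mat_def)

lemma group_GL2: "group GL2"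
proof (rule groupI)
  fix M assume "M \<in> carrier GL2"
  then have "invertible M" by (simp add: GL2_def invertible_det_nz)
  then obtain N where N: "M ** N = mat 1" "N ** M = mat 1"
    by (auto simp: invertible_def)
  then have "invertible N" by (auto simp: invertible_def)
  then show "\<exists>N\<in>carrier GL2. N \<otimes>\<^bsub>GL2\<^esub> M = \<one>\<^bsub>GL2\<^esub>"
    using N by (auto simp: GL2_def invertible_det_nz)
qed (auto simp: GL2_def det_mul matrix_mul_assoc)

interpretation GL2: group GL2
  by (rule group_GL2)

lemma GL2_simps [simp]:
  "M \<in> carrier GL2 \<longleftrightarrow> det M \<noteq> 0" "M \<otimes>\<^bsub>GL2\<^esub> N = M ** N" "\<one>\<^bsub>GL2\<^esub> = mat 1"
  by (simp_all add: GL2_def)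

lemma mat2_commute:
  fixes M :: "'a::comm_semiring_1^2^2"
  shows "mat c ** M = M ** mat c"
  by (simp add: matrix2_eq_iff matrix2_mult_nth mult.commute)

lemma mat2_mult_mat2: "(mat c :: 'a::comm_semiring_1^2^2) ** mat d = mat (c * d)"
  by (simp add: matrix2_eq_iff matrix2_mult_nth)

lemma subgroup_scalar_matrices: "subgroup scalar_matrices GL2"
proof
  show "scalar_matrices \<subseteq> carrier GL2"
    by (auto simp: scalar_matrices_def det_2)
  show "\<one>\<^bsub>GL2\<^esub> \<in> scalar_matrices"
    by (auto simp: scalar_matrices_def)
  show "x \<otimes>\<^bsub>GL2\<^esub> y \<in> scalar_matrices" if "x \<in> scalar_matrices" "y \<in> scalar_matrices" for x y
    using that by (force simp: scalar_matrices_def mat2_mult_mat2)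
  show "inv\<^bsub>GL2\<^esub> x \<in> scalar_matrices" if "x \<in> scalar_matrices" for x
  proof -
    obtain c where c: "c \<noteq> 0" "x = mat c"
      using \<open>x \<in> scalar_matrices\<close> by (auto simp: scalar_matrices_def)
    have "inv\<^bsub>GL2\<^esub> x = mat (inverse c)"
      by (rule GL2.inv_equality) (use c in \<open>simp_all add: mat2_mult_mat2 det_2\<close>)
    then show ?thesis
      using c by (auto simp: scalar_matrices_def)
  qed
qed

interpretation scalar: normal scalar_matrices GL2
proof (rule GL2.normalI[OF subgroup_scalar_matrices])
  show "\<forall>x\<in>carrier GL2. scalar_matrices #>\<^bsub>GL2\<^esub> x = x <#\<^bsub>GL2\<^esub> scalar_matrices"
    by (auto simp: r_coset_def l_coset_def scalar_matrices_def mat2_commute)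
qed

lemma group_PGL2: "group PGL2"
  unfolding PGL2_def by (rule scalar.factorgroup_is_group)

lemma pgl_hom: "pgl \<in> hom GL2 PGL2"
  unfolding PGL2_def pgl_def by (rule scalar.r_coset_hom_Mod)

lemma mem_pgl_iff: "N \<in> pgl M \<longleftrightarrow> (\<exists>c. c \<noteq> 0 \<and> N = mat c ** M)"
  by (auto simp: pgl_def r_coset_def scalar_matrices_def)

lemma mem_pgl_self: "M \<in> pgl M"
  unfolding mem_pgl_iff by (intro exI[of _ 1]) simp

lemma pgl_eqI:
  assumes "c \<noteq> 0" "N = mat c ** M"
  shows "pgl N = pgl M"
proof -
  have "mat d ** N = mat (d * c) ** M" "mat d ** M = mat (d / c) ** N" for d
    using assms by (simp_all add: matrix_mul_assoc mat2_mult_mat2)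
  then show ?thesis
    using assms(1) unfolding set_eq_iff mem_pgl_iff
    by (metis divide_eq_0_iff no_zero_divisors)
qed

lemma carrier_PGL2E:
  assumes "g \<in> carrier PGL2"
  obtains M where "det M \<noteq> 0" "g = pgl M"
  using assms by (auto simp: PGL2_def FactGroup_def RCOSETS_def pgl_def)

section \<open>The action on the Riemann sphere\<close>

lemma moebius_scalar: "c \<noteq> 0 \<Longrightarrow> moebius z (mat c ** M) = moebius z M"
proof (cases z)
  case (Some w)
  assume "c \<noteq> 0"
  have "c * M$1$2 * w + c * M$2$2 = c * (M$1$2 * w + M$2$2)"
    "c * M$1$1 * w + c * M$2$1 = c * (M$1$1 * w + M$2$1)"
    by (simp_all add: algebra_simps)
  then show ?thesis
    using Some \<open>c \<noteq> 0\<close> by (simp add: matrix2_mult_nth)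
qed (simp add: matrix2_mult_nth)

lemma moebius_mat_1 [simp]: "moebius z (mat 1) = z"
  by (cases z) auto

text \<open>\<open>p\<close> and \<open>q\<close> are homogeneous coordinates of the image of
  \<open>z\<close>. Since \<open>M\<close> is invertible they do not vanish together, and only
  \<open>q = 0\<close> is treated apart.\<close>

lemma moebius_mult:
  assumes "det M \<noteq> 0" "det N \<noteq> 0"
  shows "moebius z (M ** N) = moebius (moebius z M) N"
proof -
  define p q where "p = (case z of None \<Rightarrow> M$1$1 | Some w \<Rightarrow> M$1$1 * w + M$2$1)"
    and "q = (case z of None \<Rightarrow> M$1$2 | Some w \<Rightarrow> M$1$2 * w + M$2$2)"
  have pq: "p \<noteq> 0 \<or> q \<noteq> 0"
  proof (rule ccontr)
    assume "\<not> (p \<noteq> 0 \<or> q \<noteq> 0)"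
    then have *: "M$2$1 = - (M$1$1 * w)" "M$2$2 = - (M$1$2 * w)" if "z = Some w" for w
      using that by (simp_all add: p_def q_def add_eq_0_iff)
    have "det M = 0"
      using \<open>\<not> (p \<noteq> 0 \<or> q \<noteq> 0)\<close> *
      by (cases z) (simp_all add: p_def q_def det_2)
    then show False using assms(1) by simp
  qed
  have M: "moebius z M = (if q = 0 then None else Some (p / q))"
    by (cases z) (simp_all add: p_def q_def)
  have MN: "moebius z (M ** N) = (if p * N$1$2 + q * N$2$2 = 0 then None
      else Some ((p * N$1$1 + q * N$2$1) / (p * N$1$2 + q * N$2$2)))"
    by (cases z) (simp_all add: p_def q_def matrix2_mult_nth algebra_simps)
  show ?thesis
  proof (cases "q = 0")
    case True
    then show ?thesis using M MN pq by simp
  next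
    case False
    then have "N$1$2 * (p / q) + N$2$2 = (p * N$1$2 + q * N$2$2) / q"
      "N$1$1 * (p / q) + N$2$1 = (p * N$1$1 + q * N$2$1) / q"
      by (simp_all add: field_simps)
    then show ?thesis using M MN False by simp
  qed
qed

text \<open>Finite fixed points are roots of one quadratic polynomial, and infinity is fixed exactly
  if its leading coefficient vanishes. Three fixed points annihilate all its coefficients.\<close>

lemma moebius_fix_three:
  assumes "moebius z\<^sub>1 M = z\<^sub>1" "moebius z\<^sub>2 M = z\<^sub>2" "moebius z\<^sub>3 M = z\<^sub>3"
    and "z\<^sub>1 \<noteq> z\<^sub>2" "z\<^sub>1 \<noteq> z\<^sub>3" "z\<^sub>2 \<noteq> z\<^sub>3" "det M \<noteq> 0"
  obtains c where "c \<noteq> 0" "M = mat c"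
proof -
  have quad: "M$1$2 * z\<^sup>2 + (M$2$2 - M$1$1) * z - M$2$1 = 0" if "moebius (Some z) M = Some z" for z
    using that by (auto simp: field_simps power2_eq_square split: if_splits)
  have two: "M$1$2 * (z + w) + (M$2$2 - M$1$1) = 0"
    if "moebius (Some z) M = Some z" "moebius (Some w) M = Some w" "z \<noteq> w" for z w
  proof -
    have "(z - w) * (M$1$2 * (z + w) + (M$2$2 - M$1$1)) = 0"
      using quad[OF that(1)] quad[OF that(2)] by algebra
    then show ?thesis using that(3) by simp
  qed
  have three: "M$1$2 = 0 \<and> M$2$2 = M$1$1"
    if "moebius (Some u) M = Some u" "moebius (Some v) M = Some v" "moebius w M = w"
      "u \<noteq> v" "w \<noteq> Some u" "w \<noteq> Some v" for u v w
  proof (cases w)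
    case None
    then show ?thesis using two[OF that(1,2,4)] that(3) by (auto split: if_splits)
  next
    case (Some w')
    then have "M$1$2 * (u + w') + (M$2$2 - M$1$1) = 0"
      using two[OF that(1), of w'] that(3,5) by simp
    then have "(v - w') * M$1$2 = 0"
      using two[OF that(1,2,4)] by algebra
    then show ?thesis using Some two[OF that(1,2,4)] that(6) by auto
  qed
  \<comment> \<open>At most one of the three points is infinite; \<open>u\<close> and
    \<open>v\<close> are two finite ones.\<close>
  obtain u v w where uvw: "moebius (Some u) M = Some u" "moebius (Some v) M = Some v"
    "moebius w M = w" "u \<noteq> v" "w \<noteq> Some u" "w \<noteq> Some v"
    using assms(1-6) by (cases z\<^sub>1; cases z\<^sub>2; cases z\<^sub>3) metis+
  have "M = mat (M$1$1)"
    using three[OF uvw] quad[OF uvw(1)] by (simp add: matrix2_eq_iff)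
  moreover have "M$1$1 \<noteq> 0"
    using calculation assms(7) by (metis det_2 mat2_nth mult_zero_left diff_self)
  ultimately show ?thesis using that by blast
qed

text \<open>\<open>M\<close> times the inverse of \<open>N\<close> fixes three points, hence is
  scalar.\<close>

lemma pgl_determined_by_three_points:
  assumes "det M \<noteq> 0" "det N \<noteq> 0" and eq: "\<And>z. z \<in> Z \<Longrightarrow> moebius z M = moebius z N"
    and "{z\<^sub>1, z\<^sub>2, z\<^sub>3} \<subseteq> Z" "z\<^sub>1 \<noteq> z\<^sub>2" "z\<^sub>1 \<noteq> z\<^sub>3" "z\<^sub>2 \<noteq> z\<^sub>3"
  shows "pgl M = pgl N"
proof -
  let ?N = "inv\<^bsub>GL2\<^esub> N"
  have N: "det ?N \<noteq> 0" "N ** ?N = mat 1" "?N ** N = mat 1"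
    using GL2.inv_closed[of N] GL2.r_inv[of N] GL2.l_inv[of N] assms(2) by simp_all
  have fix_pt: "moebius z (M ** ?N) = z" if "z \<in> Z" for z
    using eq[OF that] moebius_mult[OF assms(1) N(1)] moebius_mult[OF assms(2) N(1)] N(2) by simp
  have "det (M ** ?N) \<noteq> 0"
    using assms(1) N(1) by (simp add: det_mul)
  then obtain c where c: "c \<noteq> 0" "M ** ?N = mat c"
    using moebius_fix_three[of z\<^sub>1 "M ** ?N" z\<^sub>2 z\<^sub>3] fix_pt assms(4-) by auto
  have "mat c ** N = M ** (?N ** N)"
    unfolding c(2)[symmetric] by (simp add: matrix_mul_assoc)
  then have "M = mat c ** N"
    using N(3) by simp
  then show ?thesis
    using c(1) by (rule pgl_eqI[rotated])
qed

section \<open>The color maps at a crossing\<close>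

text \<open>With denominators cleared, the later claims become polynomial identities modulo these
  equations, which \<open>algebra\<close> can decide.\<close>

lemma B_map_equations:
  fixes a1 b1 m1 a2 b2 m2 :: complex
  assumes B: "B_map ((a1, b1, m1), (a2, b2, m2)) = ((a2', b2', m2'), (a1', b1', m1'))"
    and nz: "a1 \<noteq> 0" "b1 \<noteq> 0" "m1 \<noteq> 0" "a2 \<noteq> 0" "b2 \<noteq> 0" "m2 \<noteq> 0"
    "a1' \<noteq> 0" "b1' \<noteq> 0"
  shows "m1' = m1" "m2' = m2" "a1' * a2' = a1 * a2"
    and "a1 * b2' = b1 * (a1 - m1) + b2"
    and "b1' * (m1 * b1 - m2 * a2 * (m1 * b1 - b2)) = m2 * b1 * b2"
    and "m2 * b2 * a2' = m2 * b2 * a2 - b1 * (m1 - a1) * (m2 * a2 - 1)"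
proof -
  define A where "A = 1 - m1 * b1 / b2 * (1 - a1 / m1) * (1 - 1 / (m2 * a2))"
  define K where "K = 1 - m2 * a2 * (1 - b2 / (m1 * b1))"
  have eqs: "m1' = m1" "m2' = m2" "a2' = a2 * A" "a1' = a1 * inverse A"
    "b2' = b1 * (1 - m1 / a1 * (1 - b2 / (m1 * b1)))" "b1' = m2 * b2 / m1 * inverse K"
    using B by (auto simp: B_map_def Let_def A_def K_def)
  \<comment> \<open>By the convention \<open>inverse 0 = 0\<close>, a zero of \<open>A\<close> or
    \<open>K\<close> would give \<open>a1' = 0\<close> or \<open>b1' = 0\<close>.\<close>
  have "A \<noteq> 0" "K \<noteq> 0"
    using eqs(4,6) nz(7,8) by auto
  show "m1' = m1" "m2' = m2" by fact+
  show "a1' * a2' = a1 * a2"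
    using eqs(3,4) \<open>A \<noteq> 0\<close> by simp
  show "a1 * b2' = b1 * (a1 - m1) + b2"
    using nz by (simp add: eqs field_simps)
  have "m1 * b1 * K = m1 * b1 - m2 * a2 * (m1 * b1 - b2)"
    using nz by (simp add: K_def field_simps)
  moreover have "b1' * (m1 * b1 * K) = m2 * b1 * b2"
    using nz \<open>K \<noteq> 0\<close> by (simp add: eqs field_simps)
  ultimately show "b1' * (m1 * b1 - m2 * a2 * (m1 * b1 - b2)) = m2 * b1 * b2"
    by simp
  show "m2 * b2 * a2' = m2 * b2 * a2 - b1 * (m1 - a1) * (m2 * a2 - 1)"
    using nz by (simp add: eqs A_def field_simps)
qed

lemma B_inv_map_equations:
  fixes a1 b1 m1 a2 b2 m2 :: complex
  assumes B: "B_inv_map ((a1, b1, m1), (a2, b2, m2)) = ((a2', b2', m2'), (a1', b1', m1'))"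
    and nz: "a1 \<noteq> 0" "b1 \<noteq> 0" "m1 \<noteq> 0" "a2 \<noteq> 0" "b2 \<noteq> 0" "m2 \<noteq> 0"
    "a1' \<noteq> 0" "b2' \<noteq> 0"
  shows "m1' = m1" "m2' = m2" "a1' * a2' = a1 * a2"
    and "m1 * b1' = m2 * b2 - a2 * (b2 - m1 * b1)"
    and "b2' * (m1 * a1 * b2 - (b2 - m1 * b1)) = m1 * a1 * b1 * b2"
    and "m1 * b1 * a2' = m1 * b1 * a2 - b2 * (1 - m1 * a1) * (a2 - m2)"
proof -
  define A where "A = 1 - b2 / (m1 * b1) * (1 - m1 * a1) * (1 - m2 / a2)"
  define K where "K = 1 - 1 / (m1 * a1) * (1 - m1 * b1 / b2)"
  have eqs: "m1' = m1" "m2' = m2" "a2' = a2 * A" "a1' = a1 * inverse A"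
    "b1' = m2 * b2 / m1 * (1 - a2 / m2 * (1 - m1 * b1 / b2))" "b2' = b1 * inverse K"
    using B by (auto simp: B_inv_map_def Let_def A_def K_def)
  \<comment> \<open>Here a zero of \<open>A\<close> or \<open>K\<close> would give
    \<open>a1' = 0\<close> or \<open>b2' = 0\<close>.\<close>
  have "A \<noteq> 0" "K \<noteq> 0"
    using eqs(4,6) nz(7,8) by auto
  show "m1' = m1" "m2' = m2" by fact+
  show "a1' * a2' = a1 * a2"
    using eqs(3,4) \<open>A \<noteq> 0\<close> by simp
  show "m1 * b1' = m2 * b2 - a2 * (b2 - m1 * b1)"
    using nz by (simp add: eqs field_simps)
  have "m1 * a1 * b2 * K = m1 * a1 * b2 - (b2 - m1 * b1)"
    using nz by (simp add: K_def field_simps)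
  moreover have "b2' * (m1 * a1 * b2 * K) = m1 * a1 * b1 * b2"
    using nz \<open>K \<noteq> 0\<close> by (simp add: eqs field_simps)
  ultimately show "b2' * (m1 * a1 * b2 - (b2 - m1 * b1)) = m1 * a1 * b1 * b2"
    by simp
  show "m1 * b1 * a2' = m1 * b1 * a2 - b2 * (1 - m1 * a1) * (a2 - m2)"
    using nz by (simp add: eqs A_def field_simps)
qed

section \<open>The holonomy matrices at a crossing\<close>

lemma det_rho_gen: "det (rho_gen (a, b, m) l) = a"
  by (cases l) (simp_all add: det_2)

text \<open>In the coordinate \<open>p = - 1 / z\<close> this matrix acts by the affine map
  \<open>p \<mapsto> a * p - (a - m) * b\<close>.\<close>

lemma moebius_Below:
  assumes "b \<noteq> 0" "p \<noteq> 0" "q \<noteq> 0" "q = a * p - (a - m) * b"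
  shows "moebius (Some (- 1 / p)) (rho_gen (a, b, m) Below) = Some (- 1 / q)"
proof -
  have "(a - m) * b * (- 1 / p) + a = q / p"
    using assms by (simp add: field_simps)
  then show ?thesis
    using assms(2,3) by simp
qed

text \<open>This matrix is affine in \<open>z\<close> itself; the last hypothesis equates
  \<open>- 1 / q\<close> with the image of \<open>- 1 / p\<close>, denominators cleared.\<close>

lemma moebius_Above:
  assumes "b \<noteq> 0" "m \<noteq> 0" "p \<noteq> 0" "q \<noteq> 0" "m * b * p = q * (m * a * b - (m * a - 1) * p)"
  shows "moebius (Some (- 1 / p)) (rho_gen (a, b, m) Above) = Some (- 1 / q)"
proof -
  have "a * (- 1 / p) + (a - 1 / m) / b = - 1 / q"
    using assms by (simp add: field_simps)
  then show ?thesis by simp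
qed

lemma moebius_level_vertex:
  "a \<noteq> 0 \<Longrightarrow> moebius (Some 0) (rho_gen (a, b, m) Below) = Some 0"
  "moebius None (rho_gen (a, b, m) Above) = None"
  by simp_all

text \<open>The last three equations, and the fourth of \<open>B_map_equations\<close> (\<open>B_inv_map_equations\<close>), say that
  the matrix of an inner face moves the vertex on the other strand correctly.\<close>

lemma B_map_relations:
  fixes a1 b1 m1 a2 b2 m2 :: complex
  assumes B: "B_map ((a1, b1, m1), (a2, b2, m2)) = ((a2', b2', m2'), (a1', b1', m1'))"
    and nz: "a1 \<noteq> 0" "b1 \<noteq> 0" "m1 \<noteq> 0" "a2 \<noteq> 0" "b2 \<noteq> 0" "m2 \<noteq> 0"
    "a1' \<noteq> 0" "b1' \<noteq> 0" "a2' \<noteq> 0" "b2' \<noteq> 0"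
  shows "(m2 * a2' - 1) * b2 = a1 * (m2 * a2 - 1) * b2'"
    and "a2' * (a1' - m1) * b1' = (a1 - m1) * b1"
    and "m2 * b2 = a1' * m2 * b2' - (a1' - m1) * b1'"
    and "m2 * b2' * b1 = b1' * (m2 * a2' * b2' - (m2 * a2' - 1) * b1)"
    and "m2 * b2 * b1 = b1' * (m2 * a2 * b2 - (m2 * a2 - 1) * m1 * b1)"
proof -
  note e = B_map_equations[OF B nz(1-8)]
  show i1: "(m2 * a2' - 1) * b2 = a1 * (m2 * a2 - 1) * b2'"
    using e(4,6) by algebra
  \<comment> \<open>The factor \<open>m2 * b2\<close> is the coefficient of \<open>a2'\<close> in
    \<open>e(6)\<close>; being nonzero, it is cancelled afterwards.\<close>
  have "(m2 * b2) * ((a1 * a2 - m1 * a2') * b1') = (m2 * b2) * ((a1 - m1) * b1)"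
    using e(5,6) by algebra
  then have "(a1 * a2 - m1 * a2') * b1' = (a1 - m1) * b1"
    using nz by simp
  then show i2: "a2' * (a1' - m1) * b1' = (a1 - m1) * b1"
    using e(3) by algebra
  have "a2' * (m2 * b2) = a2' * (a1' * m2 * b2' - (a1' - m1) * b1')"
    using i2 e(3,4,6) by algebra
  then show "m2 * b2 = a1' * m2 * b2' - (a1' - m1) * b1'"
    using nz by simp
  have "b2 * (m2 * b2' * b1) = b2 * (b1' * (m2 * a2' * b2' - (m2 * a2' - 1) * b1))"
    using i1 e(5,6) by algebra
  then show "m2 * b2' * b1 = b1' * (m2 * a2' * b2' - (m2 * a2' - 1) * b1)"
    using nz by simp
  show "m2 * b2 * b1 = b1' * (m2 * a2 * b2 - (m2 * a2 - 1) * m1 * b1)"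
    using e(5) by algebra
qed

lemma B_inv_map_relations:
  fixes a1 b1 m1 a2 b2 m2 :: complex
  assumes B: "B_inv_map ((a1, b1, m1), (a2, b2, m2)) = ((a2', b2', m2'), (a1', b1', m1'))"
    and nz: "a1 \<noteq> 0" "b1 \<noteq> 0" "m1 \<noteq> 0" "a2 \<noteq> 0" "b2 \<noteq> 0" "m2 \<noteq> 0"
    "a1' \<noteq> 0" "b1' \<noteq> 0" "a2' \<noteq> 0" "b2' \<noteq> 0"
  shows "(a2' - m2) * b2' = a1 * (a2 - m2) * b2"
    and "a2' * (m1 * a1' - 1) * b1 = (m1 * a1 - 1) * b1'"
    and "b1' = a2' * b1 - (a2' - m2) * b2'"
    and "m1 * b1' * b2' = b2 * (m1 * a1' * b1' - (m1 * a1' - 1) * m2 * b2')"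
    and "m1 * b1 * b2' = b2 * (m1 * a1 * b1 - (m1 * a1 - 1) * b2')"
proof -
  note e = B_inv_map_equations[OF B nz(1-7,10)]
  have "(m1 * b1) * ((a2' - m2) * b2') = (m1 * b1) * (a1 * (a2 - m2) * b2)"
    using e(5,6) by algebra
  then show n1: "(a2' - m2) * b2' = a1 * (a2 - m2) * b2"
    using nz by simp
  have "m1 * (a2' * (m1 * a1' - 1) * b1) = m1 * ((m1 * a1 - 1) * b1')"
    using e(3,4,6) by algebra
  then show n2: "a2' * (m1 * a1' - 1) * b1 = (m1 * a1 - 1) * b1'"
    using nz by simp
  have "m1 * b1' = m1 * (a2' * b1 - (a2' - m2) * b2')"
    using n1 e(4,6) by algebra
  then show "b1' = a2' * b1 - (a2' - m2) * b2'"
    using nz by simp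
  have "a2' * b1 * (m1 * b1' * b2') = a2' * b1 * (b2 * (m1 * a1' * b1' - (m1 * a1' - 1) * m2 * b2'))"
    using n1 n2 e(3,5) by algebra
  then show "m1 * b1' * b2' = b2 * (m1 * a1' * b1' - (m1 * a1' - 1) * m2 * b2')"
    using nz by simp
  show "m1 * b1 * b2' = b2 * (m1 * a1 * b1 - (m1 * a1 - 1) * b2')"
    using e(5) by algebra
qed

text \<open>At equal levels both products are affine maps (in \<open>z\<close> or in
  \<open>- 1 / z\<close>) with the same multiplier, so one point decides. At level
  \<open>Above\<close> both take P_1 from its northern to its southern place, at level
  \<open>Below\<close> P_2. The mixed relation is compared entry by entry.\<close>

lemma B_map_rho:
  fixes a1 b1 m1 a2 b2 m2 :: complex
  assumes B: "B_map ((a1, b1, m1), (a2, b2, m2)) = ((a2', b2', m2'), (a1', b1', m1'))"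
    and nz: "a1 \<noteq> 0" "b1 \<noteq> 0" "m1 \<noteq> 0" "a2 \<noteq> 0" "b2 \<noteq> 0" "m2 \<noteq> 0"
    "a1' \<noteq> 0" "b1' \<noteq> 0" "a2' \<noteq> 0" "b2' \<noteq> 0"
    and lev: "l1 = l2 \<or> (l1, l2) = (Below, Above)"
  shows "rho_gen (a1, b1, m1) l1 ** rho_gen (a2, b2, m2) l2
    = rho_gen (a2', b2', m2') l2 ** rho_gen (a1', b1', m1') l1"
proof -
  note e = B_map_equations[OF B nz(1-8)]
  note r = B_map_relations[OF B nz]
  have f1: "(a2' - 1 / m2) / b2' = a1 * (a2 - 1 / m2) / b2"
    using nz by (simp add: field_simps) (use r(1) in algebra)
  \<comment> \<open>\<open>f2\<close> and \<open>f3\<close> give the translation parts of the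
    matrices of 2' and 2, read off from how they move P_1.\<close>
  have f2: "(a2' - 1 / m2) / b2' = a2' / b1 - 1 / b1'"
    using nz by (simp add: field_simps) (use r(4) in algebra)
  have f3: "(a2 - 1 / m2) / b2 = a2 / (m1 * b1) - 1 / (m1 * b1')"
    using nz by (simp add: field_simps) (use r(5) in algebra)
  \<comment> \<open>Both sides reduce to \<open>a1 * a2 / b1 - 1 / (m1 * b1')\<close>.\<close>
  have AA: "(a1 - 1 / m1) / b1 * a2 + (a2 - 1 / m2) / b2
    = (a2' - 1 / m2) / b2' * a1' + (a1' - 1 / m1) / b1'"
    unfolding f2 f3 using nz by (simp add: field_simps) (use e(3) in algebra)
  have BB: "(a2 - m2) * b2 + (a1 - m1) * b1 * a2 = (a1' - m1) * b1' + (a2' - m2) * b2' * a1'"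
    using r(3) e(3,4) by algebra
  \<comment> \<open>\<open>BA11\<close>, \<open>BA12\<close>, \<open>BA21\<close>,
    \<open>BA22\<close> are the entries of the relation with strand 1 below and strand 2
    above.\<close>
  have BA11: "a2 + (a1 - m1) * b1 * ((a2 - 1 / m2) / b2) = a2'"
    using nz e(6) by (simp add: field_simps)
  have BA22: "a1 = (a2' - 1 / m2) / b2' * ((a1' - m1) * b1') + a1'"
  proof -
    have eq: "(a1' - m1) * b1' = a1' * m2 * b2' - m2 * b2"
      using r(3) by algebra
    have "(a2' - 1 / m2) / b2' * ((a1' - m1) * b1') + a1'
      = (m2 * a2' - 1) * a1' - (m2 * a2' - 1) * b2 / b2' + a1'"
      unfolding eq using nz by (simp add: field_simps)
    also have "\<dots> = (m2 * a2' - 1) * a1' - a1 * (m2 * a2 - 1) + a1'"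
      using r(1) nz by simp
    also have "\<dots> = a1"
      using e(3) by algebra
    finally show ?thesis by simp
  qed
  have det: "a2' * a1' = a1 * a2"
    using e(3) by (simp add: mult.commute)
  have BA12: "(a1 - m1) * b1 = a2' * ((a1' - m1) * b1')"
    using r(2) by (simp add: mult.assoc)
  have BA21: "a1 * ((a2 - 1 / m2) / b2) = (a2' - 1 / m2) / b2'"
    using f1 by simp
  from lev consider "l1 = Above" "l2 = Above" | "l1 = Below" "l2 = Below" | "l1 = Below" "l2 = Above"
    by (cases l1; cases l2) auto
  then show ?thesis
  proof cases
    case 1
    then show ?thesis using AA det by (simp add: matrix2_eq_iff matrix2_mult_nth e(1,2))
  next
    case 2
    then show ?thesis using BB det by (simp add: matrix2_eq_iff matrix2_mult_nth e(1,2))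
  next
    case 3
    show ?thesis
      unfolding 3 matrix2_eq_iff matrix2_mult_nth rho_gen.simps vector_2 e(1,2)
      using BA11 BA12 BA21 BA22 by (intro conjI) (simp_all only: mult_1 mult_1_right mult_zero_left mult_zero_right add_0 add_0_right)
  qed
qed

text \<open>As at a positive crossing, with the strands exchanged: the point followed is P_2 at
  level \<open>Above\<close> and P_1 at level \<open>Below\<close>.\<close>

lemma B_inv_map_rho:
  fixes a1 b1 m1 a2 b2 m2 :: complex
  assumes B: "B_inv_map ((a1, b1, m1), (a2, b2, m2)) = ((a2', b2', m2'), (a1', b1', m1'))"
    and nz: "a1 \<noteq> 0" "b1 \<noteq> 0" "m1 \<noteq> 0" "a2 \<noteq> 0" "b2 \<noteq> 0" "m2 \<noteq> 0"
    "a1' \<noteq> 0" "b1' \<noteq> 0" "a2' \<noteq> 0" "b2' \<noteq> 0"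
    and lev: "l1 = l2 \<or> (l1, l2) = (Above, Below)"
  shows "rho_gen (a1, b1, m1) l1 ** rho_gen (a2, b2, m2) l2
    = rho_gen (a2', b2', m2') l2 ** rho_gen (a1', b1', m1') l1"
proof -
  note e = B_inv_map_equations[OF B nz(1-7,10)]
  note r = B_inv_map_relations[OF B nz]
  have f1: "a2' * ((a1' - 1 / m1) / b1') = (a1 - 1 / m1) / b1"
    using nz by (simp add: field_simps) (use r(2) in algebra)
  have f2: "(a1' - 1 / m1) / b1' = a1' / (m2 * b2') - 1 / (m2 * b2)"
    using nz by (simp add: field_simps) (use r(4) in algebra)
  have f3: "(a1 - 1 / m1) / b1 = a1 / b2' - 1 / b2"
    using nz by (simp add: field_simps) (use r(5) in algebra)
  have AA: "(a1 - 1 / m1) / b1 * a2 + (a2 - 1 / m2) / b2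
    = (a2' - 1 / m2) / b2' * a1' + (a1' - 1 / m1) / b1'"
    \<comment> \<open>Both sides reduce to \<open>a1 * a2 / b2' - 1 / (m2 * b2)\<close>.\<close>
    unfolding f2 f3 using nz by (simp add: field_simps) (use e(3) in algebra)
  have BB: "(a2 - m2) * b2 + (a1 - m1) * b1 * a2 = (a1' - m1) * b1' + (a2' - m2) * b2' * a1'"
    using r(3) e(3,4) by algebra
  have AB22: "(a1 - 1 / m1) / b1 * ((a2 - m2) * b2) + a2 = a2'"
    using nz e(6) by (simp add: field_simps)
  have AB11: "a1 = a1' + (a2' - m2) * b2' * ((a1' - 1 / m1) / b1')"
  proof -
    have eq: "(a2' - m2) * b2' = a2' * b1 - b1'"
      using r(3) by algebra
    have "a1' + (a2' - m2) * b2' * ((a1' - 1 / m1) / b1')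
      = a1' + b1 * (a2' * ((a1' - 1 / m1) / b1')) - (a1' - 1 / m1)"
      unfolding eq using nz by (simp add: field_simps)
    also have "\<dots> = a1"
      unfolding f1 using nz by simp
    finally show ?thesis by simp
  qed
  have det: "a2' * a1' = a1 * a2"
    using e(3) by (simp add: mult.commute)
  have AB12: "a1 * ((a2 - m2) * b2) = (a2' - m2) * b2'"
    using r(1) by (simp add: mult.assoc)
  from lev consider "l1 = Above" "l2 = Above" | "l1 = Below" "l2 = Below" | "l1 = Above" "l2 = Below"
    by (cases l1; cases l2) auto
  then show ?thesis
  proof cases
    case 1
    then show ?thesis using AA det by (simp add: matrix2_eq_iff matrix2_mult_nth e(1,2))
  next
    case 2
    then show ?thesis using BB det by (simp add: matrix2_eq_iff matrix2_mult_nth e(1,2))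
  next
    case 3
    show ?thesis
      unfolding 3 matrix2_eq_iff matrix2_mult_nth rho_gen.simps vector_2 e(1,2)
      using AB11 AB12 f1 AB22 by (intro conjI) (simp_all only: mult_1 mult_1_right mult_zero_left mult_zero_right add_0 add_0_right)
  qed
qed

section \<open>Loops around the edges of the decomposition\<close>

lemma four_term_groupoid_simps [simp]:
  "objs (four_term_groupoid D) = crossings D \<times> UNIV"
  "gens (four_term_groupoid D) = faces D"
  "src (four_term_groupoid D) = face_src"
  "tgt (four_term_groupoid D) = face_tgt"
  by (simp_all add: four_term_groupoid_def dual_quiver_def)

lemma four_term_rels_iff:
  "(r, r') \<in> rels (four_term_groupoid D) \<longleftrightarrow> r' = [] \<and>
    (\<exists>T p q. p \<noteq> q \<and> is_walk (dual_quiver D) T r T \<and> around_edge D (p, q) r (p, q))"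
  by (auto simp: four_term_groupoid_def)

lemma is_walk_dual_quiver: "is_walk (dual_quiver D) u w v \<longleftrightarrow> is_walk (four_term_groupoid D) u w v"
proof (induction w arbitrary: u)
  case (Cons l w)
  then show ?case
    by (simp add: dual_quiver_def letter_src_def letter_tgt_def)
qed (simp add: dual_quiver_def)

text \<open>Faces match \<open>P_plus\<close> and \<open>P_minus\<close> only with themselves, so
  such an end persists along the walk; an inner face contains only the one of its own level.\<close>

lemma around_edge_level:
  assumes "around_edge D e w e'" "level_vertex l \<in> {fst e, snd e}" "Inner x \<sigma> \<in> fst ` set w"
  shows "inner_level D x \<sigma> = l"
  using assms
proof (induction w arbitrary: e)
  case (Cons a w)
  define V where "V = (if snd a then face_vertices D (fst a) else (face_vertices D (fst a))\<inverse>)"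
  obtain e1 where e1: "(fst e, fst e1) \<in> V" "(snd e, snd e1) \<in> V" "around_edge D e1 w e'"
    using Cons.prems(1) by (auto simp: V_def Let_def)
  have step: "v' = level_vertex l \<and> (\<forall>x \<sigma>. fst a = Inner x \<sigma> \<longrightarrow> inner_level D x \<sigma> = l)"
    if "(v, v') \<in> V" "v = level_vertex l" for v v'
  proof (cases "fst a")
    case (Inner x \<sigma>)
    then show ?thesis
      using that by (cases l; cases "inner_level D x \<sigma>") (auto simp: V_def split: if_splits)
  next
    case (Outer x i y j d)
    then show ?thesis
      using that by (cases l) (auto simp: V_def split: if_splits)
  qed
  have "level_vertex l \<in> {fst e1, snd e1}" "\<forall>x \<sigma>. fst a = Inner x \<sigma> \<longrightarrow> inner_level D x \<sigma> = l"
    using Cons.prems(2) step[OF e1(1)] step[OF e1(2)] by auto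
  then show ?case
    using Cons.IH[OF e1(3)] Cons.prems(3) by auto
qed simp

text \<open>In each of its tetrahedra an outer face has a single vertex on the strands, so it cannot
  contain both ends; inner faces keep both ends.\<close>

lemma around_edge_strands:
  assumes "around_edge D (P_strand i, P_strand j) w e'" "i \<noteq> j" "f \<in> fst ` set w"
  shows "\<exists>x \<sigma>. f = Inner x \<sigma>"
  using assms
proof (induction w)
  case (Cons a w)
  define V where "V = (if snd a then face_vertices D (fst a) else (face_vertices D (fst a))\<inverse>)"
  obtain e1 where e1: "(P_strand i, fst e1) \<in> V" "(P_strand j, snd e1) \<in> V" "around_edge D e1 w e'"
    using Cons.prems(1) by (auto simp: V_def Let_def)
  show ?case
  proof (cases "fst a")
    case (Inner x \<sigma>)
    then have "fst e1 = P_strand i" "snd e1 = P_strand j"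
      using e1(1,2) by (cases "inner_level D x \<sigma>"; auto simp: V_def split: if_splits)+
    then have "e1 = (P_strand i, P_strand j)"
      by (simp add: prod_eq_iff)
    then show ?thesis
      using Cons e1(3) Inner by auto
  next
    case (Outer x k y m d)
    then show ?thesis
      using e1(1,2) Cons.prems(2) by (auto simp: V_def split: if_splits)
  qed
qed simp

lemma inner_walk_crossing:
  assumes "is_walk (four_term_groupoid D) (x, c) w v"
    and "\<And>f. f \<in> fst ` set w \<Longrightarrow> \<exists>y \<sigma>. f = Inner y \<sigma>"
    and "f \<in> fst ` set w"
  shows "\<exists>\<sigma>. f = Inner x \<sigma>"
  using assms
proof (induction w arbitrary: c)
  case (Cons a w)
  obtain y \<sigma> where a: "fst a = Inner y \<sigma>"
    using Cons.prems(2)[of "fst a"] by auto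
  have y: "y = x" and w: "\<exists>c'. is_walk (four_term_groupoid D) (x, c') w v"
    using Cons.prems(1) a by (auto simp: letter_src_def letter_tgt_def split: if_splits)
  then show ?case
    using Cons.IH Cons.prems(2,3) a by auto
qed simp

section \<open>The comparison functor\<close>

context planar_diagram begin

lemma compare_word_level:
  assumes "\<And>x \<sigma>. Inner x \<sigma> \<in> fst ` set w \<Longrightarrow> inner_level D x \<sigma> = l"
  shows "snd ` fst ` set (compare_word D w) \<subseteq> {l}"
  using assms
proof (induction w)
  case (Cons a w)
  have "snd ` fst ` set (compare_word D w) \<subseteq> {l}"
    using Cons by auto
  moreover have "snd ` fst ` set (compare_face D (fst a)) \<subseteq> {l}"
    using Cons.prems by (cases "fst a") force+
  ultimately show ?case
    by (simp add: compare_word_def image_Un)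
qed (simp add: compare_word_def)

lemma is_walk_compare_face:
  assumes "f \<in> faces D"
  shows "is_walk (Pi1 D) (compare_obj D (face_src f)) (compare_face D f) (compare_obj D (face_tgt f))"
proof (cases f)
  case (Inner x \<sigma>)
  then have "x \<in> crossings D" using assms by (auto simp: faces_def)
  from is_walk_segment[OF this] show ?thesis
    unfolding Inner by (simp add: compare_obj_def del: is_walk.simps)
next
  case (Outer x i y j d)
  then have "x \<in> crossings D" "y \<in> crossings D" "seg D x (Out i) = seg D y (In j)"
    using assms by (auto simp: faces_def)
  \<comment> \<open>Both tetrahedra lie in the region on side \<open>d\<close> of the common
    segment, so the empty word joins them.\<close>
  then have "corner_region D x (corner_at (Out i) d) = corner_region D y (corner_at (In j) d)"
    by (metis seg_region_seg)
  then show ?thesis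
    unfolding Outer using \<open>y \<in> crossings D\<close> by (simp add: compare_obj_def corner_region_regions)
qed

lemma compare_obj_regions: "u \<in> crossings D \<times> UNIV \<Longrightarrow> compare_obj D u \<in> regions D"
  by (auto simp: compare_obj_def corner_region_regions)

lemma is_walk_compare_word:
  assumes "is_walk (four_term_groupoid D) u w v"
  shows "is_walk (Pi1 D) (compare_obj D u) (compare_word D w) (compare_obj D v)"
  unfolding compare_word_def using assms
  by (rule is_walk_word_subst) (use compare_obj_regions is_walk_compare_face in auto)

text \<open>The potential starts at the northern corner and reaches the southern one through the
  western one. Three slots extend it by definition; across segment 1' it closes up by the crossing
  relation.\<close>

lemma strand_edge_loop_trivial:
  assumes w: "is_walk (four_term_groupoid D) (x, c) w (x, c)"
    and inner: "\<And>f. f \<in> fst ` set w \<Longrightarrow> \<exists>\<sigma>. f = Inner x \<sigma>"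
  shows "weq (Pi1 D) (corner_region D x c) (compare_word D w) [] (corner_region D x c)"
proof -
  have x: "x \<in> crossings D"
    using is_walk_objs(1)[OF w] by simp
  define lt where "lt \<sigma> = ((seg D x \<sigma>, inner_level D x \<sigma>), True)" for \<sigma>
  define g where "g u = (case snd u of North \<Rightarrow> [] | West \<Rightarrow> [lt (In Strand1)]
    | South \<Rightarrow> [lt (In Strand1)] @ [lt (In Strand2)] | East \<Rightarrow> [lt (Out Strand2)])" for u :: "'x \<times> corner"
  have seg: "is_walk (Pi1 D) (corner_region D x (corner_at \<sigma> LeftSide)) [lt \<sigma>]
      (corner_region D x (corner_at \<sigma> RightSide))" for \<sigma>
    unfolding lt_def by (rule is_walk_segment[OF x])
  \<comment> \<open>The inner levels of strands 1 and 2 are exactly the mixed pair of levels that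
    the crossing relation admits.\<close>
  have rel: "weq (Pi1 D) (corner_region D x North) ([lt (In Strand1)] @ [lt (In Strand2)])
      ([lt (Out Strand2)] @ [lt (Out Strand1)]) (corner_region D x South)"
    using weq_crossing[OF x, of "inner_level D x (In Strand1)" "inner_level D x (In Strand2)"]
    by (simp add: lt_def inner_level_def)
  have walk: "is_walk (Pi1 D) (corner_region D x North) (g u) (compare_obj D u)" if u_in: "u \<in> {x} \<times> UNIV" for u
  proof -
    obtain c where u: "u = (x, c)" using u_in by (cases u) auto
    show ?thesis
      using seg[of "In Strand1"] seg[of "Out Strand2"] weq_walks(1)[OF rel] corner_region_regions[OF x, of North]
      by (cases c) (simp_all add: u g_def compare_obj_def del: is_walk.simps(2))
  qed
  have "weq (Pi1 D) (corner_region D x North) (g (x, c) @ word_subst (compare_face D) w) (g (x, c))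
      (compare_obj D (x, c))"
  proof (rule word_subst_potential[OF w, where V = "{x} \<times> UNIV"])
    fix f assume "f \<in> fst ` set w"
    then obtain \<sigma> where f: "f = Inner x \<sigma>" using inner by blast
    have cf: "compare_face D f = [lt \<sigma>]" by (simp add: f lt_def)
    have "weq (Pi1 D) (corner_region D x North) (g (x, corner_at \<sigma> LeftSide) @ [lt \<sigma>])
      (g (x, corner_at \<sigma> RightSide)) (corner_region D x (corner_at \<sigma> RightSide))"
    proof (cases "\<sigma> = Out Strand1")
      case True
      then show ?thesis using weq_sym[OF rel] by (simp add: g_def)
    next
      case False
      then have "g (x, corner_at \<sigma> LeftSide) @ [lt \<sigma>] = g (x, corner_at \<sigma> RightSide)"
        by (cases \<sigma> rule: slot_strand.cases; cases "slot_strand \<sigma>") (auto simp: g_def)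
      then show ?thesis
        using weq_refl[OF walk[of "(x, corner_at \<sigma> RightSide)"]] by (simp add: compare_obj_def)
    qed
    then show "src (four_term_groupoid D) f \<in> {x} \<times> UNIV \<and> tgt (four_term_groupoid D) f \<in> {x} \<times> UNIV \<and>
      is_walk (Pi1 D) (compare_obj D (src (four_term_groupoid D) f)) (compare_face D f)
        (compare_obj D (tgt (four_term_groupoid D) f)) \<and>
      weq (Pi1 D) (corner_region D x North) (g (src (four_term_groupoid D) f) @ compare_face D f)
        (g (tgt (four_term_groupoid D) f)) (compare_obj D (tgt (four_term_groupoid D) f))"
      unfolding cf using seg[of \<sigma>] by (simp add: f compare_obj_def del: is_walk.simps)
  qed (use walk in auto)
  then have "weq (Pi1 D) (corner_region D x North) (g (x, c) @ compare_word D w) (g (x, c))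
      (corner_region D x c)"
    by (simp add: compare_word_def compare_obj_def)
  then show ?thesis
    by (rule weq_loop_trivial)
      (use walk[of "(x, c)"] is_walk_compare_word[OF w] in \<open>simp_all add: compare_obj_def\<close>)
qed

lemma edge_loop_trivial:
  assumes w: "is_walk (four_term_groupoid D) u w u" and "p \<noteq> q" and around: "around_edge D (p, q) w (p, q)"
  shows "weq (Pi1 D) (compare_obj D u) (compare_word D w) [] (compare_obj D u)"
proof (cases "\<exists>l. level_vertex l \<in> {p, q}")
  case True
  then obtain l where "level_vertex l \<in> {fst (p, q), snd (p, q)}" by auto
  from around_edge_level[OF around this] have "snd ` fst ` set (compare_word D w) \<subseteq> {l}"
    by (rule compare_word_level)
  with is_walk_compare_word[OF w] show ?thesis
    by (rule same_level_loop_trivial)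
next
  case False
  then have "P_plus \<notin> {p, q}" "P_minus \<notin> {p, q}"
    by (metis level_vertex.simps)+
  then obtain i j where ij: "p = P_strand i" "q = P_strand j" "i \<noteq> j"
    using \<open>p \<noteq> q\<close> by (cases p; cases q) auto
  obtain x c where u: "u = (x, c)" by fastforce
  have "\<exists>\<sigma>. f = Inner x \<sigma>" if "f \<in> fst ` set w" for f
    using inner_walk_crossing[OF w[unfolded u] around_edge_strands[OF around[unfolded ij] ij(3)] that] .
  from strand_edge_loop_trivial[OF w[unfolded u] this] show ?thesis
    by (simp add: u compare_obj_def)
qed

lemma compare_functor:
  "groupoid_functor (four_term_groupoid D) (Pi1 D) (compare_obj D) (compare_word D)"
  unfolding compare_word_def
proof (rule word_subst_functor)
  fix r r' u v
  assume rel: "(r, r') \<in> rels (four_term_groupoid D)" and r: "is_walk (four_term_groupoid D) u r v"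
  then obtain T p q where "r' = []" "p \<noteq> q" "is_walk (four_term_groupoid D) T r T"
    and around: "around_edge D (p, q) r (p, q)"
    unfolding four_term_rels_iff is_walk_dual_quiver by blast
  \<comment> \<open>The first letter of a nonempty walk determines where it starts, and an empty
    walk has equal ends.\<close>
  moreover have "u = v"
    using r calculation(3) is_walk_unique by (cases r) auto
  ultimately show "weq (Pi1 D) (compare_obj D u) (word_subst (compare_face D) r)
      (word_subst (compare_face D) r') (compare_obj D v)"
    using edge_loop_trivial[of v r p q] r by (simp add: compare_word_def)
qed (use compare_obj_regions is_walk_compare_face in auto)

end


section \<open>Face maps\<close>

context planar_diagram begin

lemma crossing_colors:
  assumes \<kappa>: "chi_colored D \<kappa>" and x: "x \<in> crossings D"
  obtains a1 b1 m1 a2 b2 m2 a1' b1' a2' b2' where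
    "\<kappa> (seg D x (In Strand1)) = (a1, b1, m1)" "\<kappa> (seg D x (In Strand2)) = (a2, b2, m2)"
    "\<kappa> (seg D x (Out Strand1)) = (a1', b1', m1)" "\<kappa> (seg D x (Out Strand2)) = (a2', b2', m2)"
    "a1 \<noteq> 0" "b1 \<noteq> 0" "m1 \<noteq> 0" "a2 \<noteq> 0" "b2 \<noteq> 0" "m2 \<noteq> 0"
    "a1' \<noteq> 0" "b1' \<noteq> 0" "a2' \<noteq> 0" "b2' \<noteq> 0"
    "(if positive D x then B_map else B_inv_map) ((a1, b1, m1), (a2, b2, m2))
      = ((a2', b2', m2), (a1', b1', m1))"
proof -
  obtain a1 b1 m1 a2 b2 m2 a1' b1' m1' a2' b2' m2' where col:
    "\<kappa> (seg D x (In Strand1)) = (a1, b1, m1)" "\<kappa> (seg D x (In Strand2)) = (a2, b2, m2)"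
    "\<kappa> (seg D x (Out Strand1)) = (a1', b1', m1')" "\<kappa> (seg D x (Out Strand2)) = (a2', b2', m2')"
    by (metis prod_cases3)
  have nz: "a \<noteq> 0 \<and> b \<noteq> 0 \<and> m \<noteq> 0" if "\<kappa> (seg D x \<sigma>) = (a, b, m)" for \<sigma> a b m
    using \<kappa> that seg_segments[OF x, of \<sigma>] unfolding chi_colored_def by blast
  have B: "(if positive D x then B_map else B_inv_map) ((a1, b1, m1), (a2, b2, m2))
      = ((a2', b2', m2'), (a1', b1', m1'))"
    using \<kappa> x unfolding chi_colored_def col[symmetric] by simp
  then have "m1' = m1" "m2' = m2"
    by (auto simp: B_map_def B_inv_map_def Let_def split: if_splits)
  then show ?thesis
    using that[OF col(1,2), of a1' b1' a2' b2'] col B nz[OF col(1)] nz[OF col(2)] nz[OF col(3)] nz[OF col(4)]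
    by simp
qed

lemma rho_gen_det_nonzero:
  assumes "chi_colored D \<kappa>" "s \<in> segments D"
  shows "det (rho_gen (\<kappa> s) l) \<noteq> 0"
  using assms by (cases "\<kappa> s") (auto simp: chi_colored_def det_rho_gen)

lemma rho_gen_crossing:
  assumes "chi_colored D \<kappa>" "x \<in> crossings D"
    and "l1 = l2 \<or> (l1, l2) = (if positive D x then (Below, Above) else (Above, Below))"
  shows "rho_gen (\<kappa> (seg D x (In Strand1))) l1 ** rho_gen (\<kappa> (seg D x (In Strand2))) l2
    = rho_gen (\<kappa> (seg D x (Out Strand2))) l2 ** rho_gen (\<kappa> (seg D x (Out Strand1))) l1"
proof (rule crossing_colors[OF assms(1,2)], goal_cases)
  case (1 a1 b1 m1 a2 b2 m2 a1' b1' a2' b2')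
  show ?case
  proof (cases "positive D x")
    case True
    then show ?thesis
      unfolding 1(1-4) using 1(5-) assms(3) by (intro B_map_rho) auto
  next
    case False
    then show ?thesis
      unfolding 1(1-4) using 1(5-) assms(3) by (intro B_inv_map_rho) auto
  qed
qed

lemma holonomy_groupoid_rep:
  assumes "chi_colored D \<kappa>"
  shows "groupoid_rep (Pi1 D) GL2 (holonomy \<kappa>)"
  unfolding holonomy_def
proof (rule word_eval_groupoid_rep[OF group_GL2])
  show "(case e of (s, l) \<Rightarrow> rho_gen (\<kappa> s) l) \<in> carrier GL2" if "e \<in> gens (Pi1 D)" for e
    using that rho_gen_det_nonzero[OF assms] by auto
next
  fix r r' assume "(r, r') \<in> rels (Pi1 D)"
  then obtain x l1 l2 where x: "x \<in> crossings D"
    and lev: "l1 = l2 \<or> (l1, l2) = (if positive D x then (Below, Above) else (Above, Below))"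
    and r: "r = [((seg D x (In Strand1), l1), True), ((seg D x (In Strand2), l2), True)]"
      "r' = [((seg D x (Out Strand2), l2), True), ((seg D x (Out Strand1), l1), True)]"
    by (auto simp: Pi1_def)
  show "fst ` set r \<subseteq> gens (Pi1 D) \<and> fst ` set r' \<subseteq> gens (Pi1 D) \<and>
    word_eval GL2 (\<lambda>(s, l). rho_gen (\<kappa> s) l) r = word_eval GL2 (\<lambda>(s, l). rho_gen (\<kappa> s) l) r'"
    using rho_gen_crossing[OF assms x lev] x by (simp add: r)
qed

lemma inner_face_map:
  assumes \<kappa>: "chi_colored D \<kappa>" and x: "x \<in> crossings D"
    and v: "(v, v') \<in> face_vertices D (Inner x \<sigma>)"
  shows "moebius (place D \<kappa> (face_src (Inner x \<sigma>)) v) (rho_gen (\<kappa> (seg D x \<sigma>)) (inner_level D x \<sigma>))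
    = place D \<kappa> (face_tgt (Inner x \<sigma>)) v'"
proof (rule crossing_colors[OF \<kappa> x], goal_cases)
  case (1 a1 b1 m1 a2 b2 m2 a1' b1' a2' b2')
  note col = 1(1-4) and nz = 1(5-14)
  have vertices: "v' = v \<and> v = P_strand Strand1 \<or> v' = v \<and> v = P_strand Strand2 \<or>
      v' = v \<and> v = level_vertex (inner_level D x \<sigma>)"
    using v by auto
  have slots: "\<sigma> = In Strand1 \<or> \<sigma> = In Strand2 \<or> \<sigma> = Out Strand1 \<or> \<sigma> = Out Strand2"
    by (metis slot.exhaust strand.exhaust)
  have places: "place D \<kappa> (x, c) (P_strand Strand1) = Some (- 1 / (case c of
      North \<Rightarrow> b1 | West \<Rightarrow> m1 * b1 | South \<Rightarrow> m1 * b1' | East \<Rightarrow> b1'))"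
    "place D \<kappa> (x, c) (P_strand Strand2) = Some (- 1 / (case c of
      North \<Rightarrow> b2' | West \<Rightarrow> b2 | South \<Rightarrow> m2 * b2 | East \<Rightarrow> m2 * b2'))" for c
    by (cases c; simp add: col)+
  note simps = places place.simps(1,2) face_src.simps face_tgt.simps corner_at.simps corner.case
    slot_strand.simps strand.case inner_level_def level_vertex.simps moebius_level_vertex
  show ?case
  proof (cases "positive D x")
    case True
    then have B: "B_map ((a1, b1, m1), (a2, b2, m2)) = ((a2', b2', m2), (a1', b1', m1))"
      using 1(15) by simp
    note e = B_map_equations[OF B nz(1-8)] and r = B_map_relations[OF B nz]
    \<comment> \<open>For each slot, the first fact moves the vertex on the segment's own strand, an
      identity in its color alone; the fact with the added prime moves the vertex on the other
      strand and uses the coloring equations.\<close>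
    have in1: "moebius (Some (- 1 / b1)) (rho_gen (a1, b1, m1) Below) = Some (- 1 / (m1 * b1))"
    proof (rule moebius_Below)
      show "(m1 * b1) = a1 * b1 - (a1 - m1) * b1"
        by algebra
    qed (use nz in simp_all)
    have in1': "moebius (Some (- 1 / b2')) (rho_gen (a1, b1, m1) Below) = Some (- 1 / b2)"
    proof (rule moebius_Below)
      show "b2 = a1 * b2' - (a1 - m1) * b1"
        using e(4) by algebra
    qed (use nz in simp_all)
    have in2: "moebius (Some (- 1 / b2)) (rho_gen (a2, b2, m2) Above) = Some (- 1 / (m2 * b2))"
    proof (rule moebius_Above)
      show "m2 * b2 * b2 = (m2 * b2) * (m2 * a2 * b2 - (m2 * a2 - 1) * b2)"
        by algebra
    qed (use nz in simp_all)
    have in2': "moebius (Some (- 1 / (m1 * b1))) (rho_gen (a2, b2, m2) Above) = Some (- 1 / (m1 * b1'))"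
    proof (rule moebius_Above)
      show "m2 * b2 * (m1 * b1) = (m1 * b1') * (m2 * a2 * b2 - (m2 * a2 - 1) * (m1 * b1))"
        using r(5) by algebra
    qed (use nz in simp_all)
    have out1: "moebius (Some (- 1 / b1')) (rho_gen (a1', b1', m1) Below) = Some (- 1 / (m1 * b1'))"
    proof (rule moebius_Below)
      show "(m1 * b1') = a1' * b1' - (a1' - m1) * b1'"
        by algebra
    qed (use nz in simp_all)
    have out1': "moebius (Some (- 1 / (m2 * b2'))) (rho_gen (a1', b1', m1) Below) = Some (- 1 / (m2 * b2))"
    proof (rule moebius_Below)
      show "(m2 * b2) = a1' * (m2 * b2') - (a1' - m1) * b1'"
        using r(3) by algebra
    qed (use nz in simp_all)
    have out2: "moebius (Some (- 1 / b2')) (rho_gen (a2', b2', m2) Above) = Some (- 1 / (m2 * b2'))"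
    proof (rule moebius_Above)
      show "m2 * b2' * b2' = (m2 * b2') * (m2 * a2' * b2' - (m2 * a2' - 1) * b2')"
        by algebra
    qed (use nz in simp_all)
    have out2': "moebius (Some (- 1 / b1)) (rho_gen (a2', b2', m2) Above) = Some (- 1 / b1')"
    proof (rule moebius_Above)
      show "m2 * b2' * b1 = b1' * (m2 * a2' * b2' - (m2 * a2' - 1) * b1)"
        by (fact r(4))
    qed (use nz in simp_all)
    show ?thesis
      using slots vertices
      by (elim disjE; simp only: simps col True if_True if_False nz not_False_eq_True
          in1 in1' in2 in2' out1 out1' out2 out2')
  next
    case False
    then have B: "B_inv_map ((a1, b1, m1), (a2, b2, m2)) = ((a2', b2', m2), (a1', b1', m1))"
      using 1(15) by simp
    note e = B_inv_map_equations[OF B nz(1-7,10)] and r = B_inv_map_relations[OF B nz]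
    have in1: "moebius (Some (- 1 / b1)) (rho_gen (a1, b1, m1) Above) = Some (- 1 / (m1 * b1))"
    proof (rule moebius_Above)
      show "m1 * b1 * b1 = (m1 * b1) * (m1 * a1 * b1 - (m1 * a1 - 1) * b1)"
        by algebra
    qed (use nz in simp_all)
    have in1': "moebius (Some (- 1 / b2')) (rho_gen (a1, b1, m1) Above) = Some (- 1 / b2)"
    proof (rule moebius_Above)
      show "m1 * b1 * b2' = b2 * (m1 * a1 * b1 - (m1 * a1 - 1) * b2')"
        by (fact r(5))
    qed (use nz in simp_all)
    have in2: "moebius (Some (- 1 / b2)) (rho_gen (a2, b2, m2) Below) = Some (- 1 / (m2 * b2))"
    proof (rule moebius_Below)
      show "(m2 * b2) = a2 * b2 - (a2 - m2) * b2"
        by algebra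
    qed (use nz in simp_all)
    have in2': "moebius (Some (- 1 / (m1 * b1))) (rho_gen (a2, b2, m2) Below) = Some (- 1 / (m1 * b1'))"
    proof (rule moebius_Below)
      show "(m1 * b1') = a2 * (m1 * b1) - (a2 - m2) * b2"
        using e(4) by algebra
    qed (use nz in simp_all)
    have out1: "moebius (Some (- 1 / b1')) (rho_gen (a1', b1', m1) Above) = Some (- 1 / (m1 * b1'))"
    proof (rule moebius_Above)
      show "m1 * b1' * b1' = (m1 * b1') * (m1 * a1' * b1' - (m1 * a1' - 1) * b1')"
        by algebra
    qed (use nz in simp_all)
    have out1': "moebius (Some (- 1 / (m2 * b2'))) (rho_gen (a1', b1', m1) Above) = Some (- 1 / (m2 * b2))"
    proof (rule moebius_Above)
      show "m1 * b1' * (m2 * b2') = (m2 * b2) * (m1 * a1' * b1' - (m1 * a1' - 1) * (m2 * b2'))"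
        using r(4) by algebra
    qed (use nz in simp_all)
    have out2: "moebius (Some (- 1 / b2')) (rho_gen (a2', b2', m2) Below) = Some (- 1 / (m2 * b2'))"
    proof (rule moebius_Below)
      show "(m2 * b2') = a2' * b2' - (a2' - m2) * b2'"
        by algebra
    qed (use nz in simp_all)
    have out2': "moebius (Some (- 1 / b1)) (rho_gen (a2', b2', m2) Below) = Some (- 1 / b1')"
    proof (rule moebius_Below)
      show "b1' = a2' * b1 - (a2' - m2) * b2'"
        by (fact r(3))
    qed (use nz in simp_all)
    show ?thesis
      using slots vertices
      by (elim disjE; simp only: simps col False if_True if_False nz not_False_eq_True
          in1 in1' in2 in2' out1 out1' out2 out2')
  qed
qed

text \<open>The place is a function of the segment's color and the side only, so the two ends of a
  segment agree. This is why outer faces are glued by the identity.\<close>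

lemma place_own_strand:
  assumes "\<kappa> (seg D x \<sigma>) = (a, b, m)"
    and "chi_colored D \<kappa>" "x \<in> crossings D"
  shows "place D \<kappa> (x, corner_at \<sigma> e) (P_strand (slot_strand \<sigma>))
    = Some (case e of LeftSide \<Rightarrow> - 1 / b | RightSide \<Rightarrow> - 1 / (m * b))"
proof (rule crossing_colors[OF assms(2,3)], goal_cases)
  case (1 a1 b1 m1 a2 b2 m2 a1' b1' a2' b2')
  obtain i where "\<sigma> = In i \<or> \<sigma> = Out i" by (cases \<sigma>) auto
  then show ?case
    using 1(1-4) assms(1) by (cases i; cases e) auto
qed

lemma outer_face_map:
  assumes \<kappa>: "chi_colored D \<kappa>" and f: "Outer x i y j d \<in> faces D"
    and v: "(v, v') \<in> face_vertices D (Outer x i y j d)"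
  shows "place D \<kappa> (face_src (Outer x i y j d)) v = place D \<kappa> (face_tgt (Outer x i y j d)) v'"
proof -
  have xy: "x \<in> crossings D" "y \<in> crossings D" and eq: "seg D x (Out i) = seg D y (In j)"
    using f by (auto simp: faces_def)
  obtain a b m where abm: "\<kappa> (seg D x (Out i)) = (a, b, m)" by (metis prod_cases3)
  show ?thesis
    using v place_own_strand[OF abm \<kappa> xy(1), of d] place_own_strand[OF abm[unfolded eq] \<kappa> xy(2), of d]
    by (auto simp del: place.simps(3))
qed

text \<open>Scalars act trivially, so one matrix speaks for all representatives of its
  class.\<close>

lemma is_face_map_pgl:
  assumes "det M \<noteq> 0"
    and "\<And>v v'. (v, v') \<in> face_vertices D f \<Longrightarrow>
      moebius (place D \<kappa> (face_src f) v) M = place D \<kappa> (face_tgt f) v'"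
  shows "is_face_map D \<kappa> f (pgl M)"
  unfolding is_face_map_def
  using assms hom_in_carrier[OF pgl_hom, of M] by (auto simp: mem_pgl_iff moebius_scalar)

lemma compare_face_map:
  assumes \<kappa>: "chi_colored D \<kappa>" and f: "f \<in> faces D"
  shows "is_face_map D \<kappa> f (pgl (holonomy \<kappa> (compare_face D f)))"
proof (cases f)
  case (Inner x \<sigma>)
  then have x: "x \<in> crossings D" using f by (auto simp: faces_def)
  have "holonomy \<kappa> (compare_face D f) = rho_gen (\<kappa> (seg D x \<sigma>)) (inner_level D x \<sigma>)"
    by (simp add: Inner holonomy_def)
  then show ?thesis
    using inner_face_map[OF \<kappa> x] rho_gen_det_nonzero[OF \<kappa> seg_segments[OF x]]
    unfolding Inner by (intro is_face_map_pgl) auto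
next
  case (Outer x i y j d)
  have "holonomy \<kappa> (compare_face D f) = mat 1"
    by (simp add: Outer holonomy_def)
  then show ?thesis
    using outer_face_map[OF \<kappa> f[unfolded Outer]]
    unfolding Outer by (intro is_face_map_pgl) auto
qed

end

lemma face_map_unique:
  assumes g: "is_face_map D \<kappa> f g" and h: "is_face_map D \<kappa> f h" and f: "nondegenerate_face D \<kappa> f"
  shows "g = h"
proof -
  obtain M where M: "det M \<noteq> 0" "g = pgl M"
    using g by (auto simp: is_face_map_def elim: carrier_PGL2E)
  obtain N where N: "det N \<noteq> 0" "h = pgl N"
    using h by (auto simp: is_face_map_def elim: carrier_PGL2E)
  let ?pl = "place D \<kappa> (face_src f)"
  \<comment> \<open>Every face has three differently named vertices; nondegeneracy makes their
    places distinct.\<close>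
  obtain v1 v2 v3 where v: "{v1, v2, v3} \<subseteq> Domain (face_vertices D f)" "v1 \<noteq> v2" "v1 \<noteq> v3" "v2 \<noteq> v3"
  proof (cases f)
    case (Inner x \<sigma>)
    then show ?thesis
      using that[of "P_strand Strand1" "P_strand Strand2" "level_vertex (inner_level D x \<sigma>)"]
      by (cases "inner_level D x \<sigma>") auto
  next
    case (Outer x i y j d)
    then show ?thesis
      using that[of "P_strand i" P_plus P_minus] by auto
  qed
  have "moebius z M = moebius z N" if "z \<in> ?pl ` Domain (face_vertices D f)" for z
    using that g h mem_pgl_self[of M] mem_pgl_self[of N] unfolding is_face_map_def M(2) N(2) by fastforce
  then show ?thesis
    unfolding M(2) N(2) using v f M(1) N(1)
    by (intro pgl_determined_by_three_points[of M N "?pl ` Domain (face_vertices D f)" "?pl v1" "?pl v2" "?pl v3"])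
      (auto simp: nondegenerate_face_def inj_on_eq_iff)
qed

theorem theorem4p8:
  fixes D :: "('x, 's, 'r) diagram" and \<kappa> :: "'s \<Rightarrow> color"
  assumes "link_diagram D" and "chi_colored D \<kappa>"
  shows "groupoid_rep (Pi1 D) GL2 (holonomy \<kappa>) \<and>
    groupoid_functor (four_term_groupoid D) (Pi1 D) (compare_obj D) (compare_word D) \<and>
    generated_by_face_maps D \<kappa> (\<lambda>w. pgl (holonomy \<kappa> (compare_word D w))) \<and>
    (\<forall>\<Phi> u w v. generated_by_face_maps D \<kappa> \<Phi> \<longrightarrow> is_walk (four_term_groupoid D) u w v \<longrightarrow>
       (\<forall>f\<in>fst ` set w. nondegenerate_face D \<kappa> f) \<longrightarrow>
       \<Phi> w = pgl (holonomy \<kappa> (compare_word D w)))"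
proof -
  interpret planar_diagram D by unfold_locales fact
  let ?\<Psi> = "\<lambda>w. pgl (holonomy \<kappa> (compare_word D w))"
  \<comment> \<open>The comparison functor, followed by the holonomy in \<open>GL2\<close> and the
    projection to \<open>PGL2\<close>.\<close>
  have rep: "groupoid_rep (four_term_groupoid D) PGL2 ?\<Psi>"
    by (rule groupoid_rep_hom[OF groupoid_rep_functor[OF compare_functor
          holonomy_groupoid_rep[OF assms(2)]] pgl_hom])
  have face: "is_face_map D \<kappa> f (?\<Psi> [(f, True)])" if "f \<in> faces D" for f
    using compare_face_map[OF assms(2) that] by (simp add: compare_word_def)
  have "\<Phi> w = ?\<Psi> w"
    if \<Phi>: "generated_by_face_maps D \<kappa> \<Phi>" and w: "is_walk (four_term_groupoid D) u w v"
      and nondeg: "\<forall>f\<in>fst ` set w. nondegenerate_face D \<kappa> f" for \<Phi> u w v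
  proof (rule groupoid_rep_eqI[OF group_PGL2 _ rep w])
    show "groupoid_rep (four_term_groupoid D) PGL2 \<Phi>"
      using \<Phi> by (simp add: generated_by_face_maps_def)
    show "\<Phi> [(f, True)] = ?\<Psi> [(f, True)]" if f: "f \<in> fst ` set w" for f
    proof -
      have "f \<in> faces D" using is_walk_gens[OF w] f by auto
      then show ?thesis
        using face_map_unique[OF _ face bspec[OF nondeg f]] \<Phi> by (simp add: generated_by_face_maps_def)
    qed
  qed
  then show ?thesis
    using holonomy_groupoid_rep[OF assms(2)] compare_functor rep face
    by (simp add: generated_by_face_maps_def)
qed

end
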